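(* Suppose that $G$ is a countable discrete group, that $T:G\curvearrowright (X,\mu)$ is a probability-preserving, topological action on a compact metric space $X$ (that is, $G$ acts on $X$ by homeomorphisms $T^g$, $g\in G$, each preserving the Borel probability measure $\mu$), that $\mathbf{p} = (p_1,\ldots,p_k)$ is a finite-complexity $G$-system (a tuple of functions $p_i:\mathbb{Z}\to G$, of finite complexity), and that $f_1,\ldots,f_k \in L^\infty(\mu)$. Then the averages \[\frac{1}{N}\sum_{n=1}^N (f_1\circ T^{p_1(n)})(f_2\circ T^{p_2(n)})\cdots (f_k\circ T^{p_k(n)})\] converge in $\|\cdot\|_2$ (the norm of $L^2(\mu)$) as $N\to\infty$.
   Context: For a group $\Gamma$, a $\Gamma$-sequence is a function $\mathbb{Z}\to\Gamma$, and a $\Gamma$-system is a finite tuple of $\Gamma$-sequences. The set $\Gamma^{\mathbb{Z}}$ of $\Gamma$-sequences is a group under coordinate-wise operations, with shift automorphism $\alpha$ given by $\alpha(p)(n):=p(n-1)$. Let $\iota:\Gamma\to\Gamma^{\mathbb{Z}}$ be the embedding of $\Gamma$ as the constant functions, and write $e$ for the identity of both $\Gamma$ and $\Gamma^{\mathbb{Z}}$. For $p,q\in\Gamma^{\mathbb{Z}}$ define the map \[\langle p|q\rangle:\mathbb{Z}\to\Gamma^{\mathbb{Z}},\qquad \langle p|q\rangle(n):=\alpha^{-n}(qp^{-1})\cdot\iota(p(n)),\] i.e. $\langle p|q\rangle(n)$ is the $\Gamma$-sequence $m\mapsto q(n+m)p(n+m)^{-1}p(n)$. The reduction of a $\Gamma$-system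 $\mathbf{p}=(p_1,\ldots,p_k)$ is the $\Gamma^{\mathbb{Z}}$-system \[\mathbf{p}^\ast:=(\iota\circ p_1,\ldots,\iota\circ p_{k-1},\langle p_k|e\rangle,\langle p_k|p_1\rangle,\ldots,\langle p_k|p_{k-1}\rangle).\] A $\Gamma$-system is trivial if all its entries are constant functions. A $\Gamma$-system has finite complexity if it may be converted into a trivial system by a finite sequence of operations, each of which is either a reduction (which changes the group from $\Gamma$ to $\Gamma^{\mathbb{Z}}$), a re-ordering of the entries, or a removal of duplicated entries. Its complexity is the least number of reductions needed in such a sequence of operations. *)

theory Defs
  imports "HOL-Probability.Probability" "HOL-Algebra.Algebra"
begin

section \<open>Sequences in a group, and the reduction of a system\<close>

text \<open>
  A sequence in a group \<open>\<Gamma>\<close> is a function \<open>int \<Rightarrow> 'a\<close> with values in the carrier, a system is a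
  finite list of sequences, and \<open>seq_group \<Gamma>\<close> is the group of all sequences in \<open>\<Gamma>\<close> under
  coordinate-wise operations.
\<close>

abbreviation seq_group :: "('a, 'b) monoid_scheme \<Rightarrow> (int \<Rightarrow> 'a) monoid"
  where "seq_group \<Gamma> \<equiv> product_group UNIV (\<lambda>_. \<Gamma>)"

definition is_system :: "('a, 'b) monoid_scheme \<Rightarrow> (int \<Rightarrow> 'a) list \<Rightarrow> bool"
  where "is_system \<Gamma> ps \<longleftrightarrow> (\<forall>p \<in> set ps. p \<in> carrier (seq_group \<Gamma>))"

definition trivial_system :: "(int \<Rightarrow> 'a) list \<Rightarrow> bool"
  where "trivial_system ps \<longleftrightarrow> (\<forall>p \<in> set ps. p constant_on UNIV)"

text \<open>
  \<open>shift j\<close> is the \<open>j\<close>-th power \<open>\<alpha>\<^sup>j\<close> (for \<open>j\<close> an arbitrary integer) of the shift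
  automorphism \<open>\<alpha>\<close>, which sends \<open>p\<close> to \<open>\<lambda>n. p (n - 1)\<close>.
\<close>

definition shift :: "int \<Rightarrow> (int \<Rightarrow> 'a) \<Rightarrow> int \<Rightarrow> 'a"
  where "shift j p = (\<lambda>n. p (n - j))"

lemma shift_zero: "shift 0 = id"
  by (simp add: shift_def fun_eq_iff)

lemma shift_one: "shift 1 p n = p (n - 1)"
  by (simp add: shift_def)

lemma shift_add: "shift (i + j) = shift i \<circ> shift j"
  by (simp add: shift_def fun_eq_iff algebra_simps)

definition const_seq :: "'a \<Rightarrow> int \<Rightarrow> 'a"  ("\<iota>")
  where "\<iota> a = (\<lambda>_. a)"

definition bracket ::
    "('a, 'b) monoid_scheme \<Rightarrow> (int \<Rightarrow> 'a) \<Rightarrow> (int \<Rightarrow> 'a) \<Rightarrow> int \<Rightarrow> (int \<Rightarrow> 'a)"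
  where "bracket \<Gamma> p q n =
    shift (- n) (q \<otimes>\<^bsub>seq_group \<Gamma>\<^esub> inv\<^bsub>seq_group \<Gamma>\<^esub> p) \<otimes>\<^bsub>seq_group \<Gamma>\<^esub> \<iota> (p n)"

lemma bracket_apply:
  assumes "group \<Gamma>" "p \<in> carrier (seq_group \<Gamma>)"
  shows "bracket \<Gamma> p q n m = q (n + m) \<otimes>\<^bsub>\<Gamma>\<^esub> inv\<^bsub>\<Gamma>\<^esub> p (n + m) \<otimes>\<^bsub>\<Gamma>\<^esub> p n"
  using assms by (simp add: bracket_def shift_def const_seq_def add.commute)

text \<open>
  For \<open>ps = [p\<^sub>1, \<dots>, p\<^sub>k]\<close> with \<open>k \<ge> 1\<close>, \<open>butlast ps\<close> is \<open>[p\<^sub>1, \<dots>, p\<^sub>k\<^sub>-\<^sub>1]\<close> and \<open>last ps\<close> is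
  \<open>p\<^sub>k\<close>.
\<close>

definition reduction ::
    "('a, 'b) monoid_scheme \<Rightarrow> (int \<Rightarrow> 'a) list \<Rightarrow> (int \<Rightarrow> (int \<Rightarrow> 'a)) list"
  where "reduction \<Gamma> ps =
    map (\<lambda>p. \<iota> \<circ> p) (butlast ps) @
    map (bracket \<Gamma> (last ps)) (\<one>\<^bsub>seq_group \<Gamma>\<^esub> # butlast ps)"


section \<open>Finite complexity\<close>

text \<open>
  Each reduction changes the underlying group from \<open>\<Gamma>\<close> to \<open>seq_group \<Gamma>\<close>, hence also its type. To
  speak about finitely many reductions in a row, the groups obtained from \<open>G\<close> by iterating
  \<open>seq_group\<close> are transported along the injective constructors \<open>Base\<close> and \<open>Seq\<close> into a single
  type: \<open>tower_group G j\<close> is a copy of the \<open>j\<close>-fold iterate.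
\<close>

datatype 'a tower = Base 'a | Seq "int \<Rightarrow> 'a tower"

primrec tower_group :: "('a, 'b) monoid_scheme \<Rightarrow> nat \<Rightarrow> 'a tower monoid"
  where
    "tower_group G 0 = image_group Base G"
  | "tower_group G (Suc j) = image_group Seq (seq_group (tower_group G j))"

lemma image_group_iso:
  assumes "group H" "inj \<phi>"
  shows "group (image_group \<phi> H)" and "\<phi> \<in> iso H (image_group \<phi> H)"
proof -
  have inv_into: "inv_into (carrier H) \<phi> (\<phi> x) = x" if "x \<in> carrier H" for x
    using that assms(2) by (meson inj_on_subset inv_into_f_f subset_UNIV)
  interpret group H by fact
  show *: "\<phi> \<in> iso H (image_group \<phi> H)"
    using assms(2)
    by (auto simp: iso_def hom_def image_group_def inv_into bij_betw_def intro: inj_on_subset)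
  show "group (image_group \<phi> H)"
  proof (rule groupI)
    fix x assume "x \<in> carrier (image_group \<phi> H)"
    then obtain a where a: "a \<in> carrier H" "x = \<phi> a"
      by (auto simp: image_group_def)
    show "\<exists>y\<in>carrier (image_group \<phi> H). y \<otimes>\<^bsub>image_group \<phi> H\<^esub> x = \<one>\<^bsub>image_group \<phi> H\<^esub>"
      using a by (intro bexI[of _ "\<phi> (inv\<^bsub>H\<^esub> a)"]) (auto simp: image_group_def inv_into)
  qed (auto simp: image_group_def inv_into m_assoc)
qed

lemma tower_group_group: "group G \<Longrightarrow> group (tower_group G j)"
  by (induction j) (auto intro!: image_group_iso(1) product_group simp: inj_def)

lemma Base_iso: "group G \<Longrightarrow> Base \<in> iso G (tower_group G 0)"
  by (auto intro!: image_group_iso(2) simp: inj_def)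

lemma Seq_iso: "group G \<Longrightarrow> Seq \<in> iso (seq_group (tower_group G j)) (tower_group G (Suc j))"
  by (auto intro!: image_group_iso(2) product_group tower_group_group simp: inj_def)

text \<open>
  In \<open>(j, ps)\<close>, the list \<open>ps\<close> is a system in \<open>tower_group G j\<close>. The empty system has no
  reduction. The rule \<open>dedup\<close> removes one entry that also occurs elsewhere in the list.
\<close>

inductive system_step ::
    "('a, 'b) monoid_scheme \<Rightarrow> nat \<times> (int \<Rightarrow> 'a tower) list \<Rightarrow> nat \<times> (int \<Rightarrow> 'a tower) list \<Rightarrow> bool"
  for G
  where
    reduce: "ps \<noteq> [] \<Longrightarrow>
      system_step G (j, ps) (Suc j, map (\<lambda>p. Seq \<circ> p) (reduction (tower_group G j) ps))"
  | reorder: "mset qs = mset ps \<Longrightarrow> system_step G (j, ps) (j, qs)"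
  | dedup: "p \<in> set (ps @ qs) \<Longrightarrow> system_step G (j, ps @ p # qs) (j, ps @ qs)"

definition finite_complexity :: "('a, 'b) monoid_scheme \<Rightarrow> (int \<Rightarrow> 'a) list \<Rightarrow> bool"
  where "finite_complexity G ps \<longleftrightarrow>
    (\<exists>j qs. (system_step G)\<^sup>*\<^sup>* (0, map (\<lambda>p. Base \<circ> p) ps) (j, qs) \<and> trivial_system qs)"


section \<open>Function spaces over a measure\<close>

definition L_infinity :: "'x measure \<Rightarrow> ('x \<Rightarrow> complex) set"
  where "L_infinity M = {f \<in> borel_measurable M. \<exists>C. AE x in M. cmod (f x) \<le> C}"

definition L_two :: "'x measure \<Rightarrow> ('x \<Rightarrow> complex) set"
  where "L_two M = {f \<in> borel_measurable M. integrable M (\<lambda>x. (cmod (f x))\<^sup>2)}"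

definition L_two_norm :: "'x measure \<Rightarrow> ('x \<Rightarrow> complex) \<Rightarrow> real"
  where "L_two_norm M f = sqrt (\<integral>x. (cmod (f x))\<^sup>2 \<partial>M)"

end

theory Submission
  imports Defs
begin

text \<open>
  Write \<open>Q\<^sub>n = \<Prod>i<k. f\<^sub>i \<circ> T\<^bsup>p\<^sub>i(n)\<^esup>\<close> and, for a bounded function \<open>h\<close> in the place of \<open>f\<^sub>k\<close>,
  \<open>A\<^sub>N h = (1/N) \<Sum>n\<le>N. Q\<^sub>n \<cdot> (h \<circ> T\<^bsup>p\<^sub>k(n)\<^esup>)\<close>. One would like to split \<open>h = v + u\<close>, where \<open>v\<close> lies in the
  closed subspace of all functions with Cauchy averages and \<open>u\<close> is orthogonal to it, and to show that
  \<open>A\<^sub>N u\<close> tends to zero. The obstruction to this is the dual function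
  \<open>D\<^sub>N = (1/N) \<Sum>m\<le>N. (A\<^sub>N u \<cdot> cnj Q\<^sub>m) \<circ> (T\<^bsup>p\<^sub>k(m)\<^esup>)\<^sup>-\<^sup>1\<close>, for which the inner product of \<open>u\<close>
  with \<open>D\<^sub>N\<close> is the squared norm of \<open>A\<^sub>N u\<close> (lemma \<open>dual_inner\<close>). For \<open>n\<close> much smaller than \<open>N\<close> the sum
  over \<open>m\<close> may be shifted by \<open>n\<close> at a small cost, and then \<open>D\<^sub>N (T\<^bsup>p\<^sub>k(n)\<^esup> x)\<close> involves the group elements
  \<open>p\<^sub>i(n+m) p\<^sub>k(n+m)\<^sup>-\<^sup>1 p\<^sub>k(n)\<close> and \<open>p\<^sub>k(n+m)\<^sup>-\<^sup>1 p\<^sub>k(n)\<close>, which are the values at \<open>m\<close> of the brackets in the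
  reduced system (lemma \<open>dual_averages_cauchy\<close>). So the averages \<open>A\<^sub>n D\<^sub>N\<close> are controlled by those of the
  reduction, and an induction on the number of reductions suggests itself.

  The difficulty is that \<open>D\<^sub>N\<close> changes with \<open>N\<close>. Therefore a function on \<open>X\<close> is replaced by a bounded
  sequence \<open>(F\<^sub>i)\<close> of functions, with the seminorm whose square is \<open>\<Phi>(i \<mapsto> \<integral>\<bar>F\<^sub>i\<bar>\<^sup>2)\<close> for a mean \<open>\<Phi>\<close> on bounded
  sequences of reals. All the \<open>D\<^sub>N\<close> together form a single element of such a space, over a larger
  index set and with a mean that only sees \<open>N \<rightarrow> \<infinity>\<close>. The inductive statement (\<open>convergent_on\<close>) asks for
  Cauchy averages for all means and all sequences of homomorphisms \<open>c\<^sub>i\<close> from the group \<open>\<Gamma>\<close> of the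
  system to \<open>G\<close>, where \<open>\<Gamma>\<close> acts on the \<open>i\<close>-th function through \<open>c\<^sub>i\<close>. It applies to the reduction,
  because the group of \<open>\<Gamma>\<close>-sequences acts at the index \<open>(i, N, m)\<close> through \<open>q \<mapsto> c\<^sub>i(q(m))\<close>. All index sets
  are coded by natural numbers, hence every extension is an object of the same kind.

  The splitting of \<open>h\<close> is replaced by an extremal argument (\<open>wavg_cauchy_of_dual_averages\<close>). Let \<open>d\<close> be
  the infimum of the squared distance of \<open>h\<close> to an element with Cauchy averages, over all
  extensions at once. Take an extension and a \<open>v\<close> in it that nearly attain \<open>d\<close>, and let \<open>u = h - v\<close>. If the
  squared norm of \<open>A\<^sub>N u\<close> were not small for infinitely many \<open>N\<close>, then in the further extension along
  these \<open>N\<close> the element \<open>v + t D\<close> with a suitable \<open>t > 0\<close> would still have Cauchy averages, and its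
  squared distance from \<open>h\<close> would be less than \<open>d\<close>. So \<open>A\<^sub>N u\<close> is eventually small, and \<open>A\<^sub>N h\<close> is
  Cauchy up to a small error.
\<close>

section \<open>Means on bounded sequences\<close>

definition is_mean :: "((nat \<Rightarrow> real) \<Rightarrow> real) \<Rightarrow> bool"
  where "is_mean \<Phi> \<longleftrightarrow>
    (\<forall>a b. Bseq a \<longrightarrow> Bseq b \<longrightarrow> \<Phi> (\<lambda>i. a i + b i) = \<Phi> a + \<Phi> b) \<and>
    (\<forall>a c. Bseq a \<longrightarrow> \<Phi> (\<lambda>i. c * a i) = c * \<Phi> a) \<and>
    (\<forall>a. Bseq a \<longrightarrow> (\<forall>i. 0 \<le> a i) \<longrightarrow> 0 \<le> \<Phi> a) \<and>
    \<Phi> (\<lambda>_. 1) = 1"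

lemma Bseq_plus:
  fixes a b :: "nat \<Rightarrow> real"
  assumes "Bseq a" "Bseq b" shows "Bseq (\<lambda>i. a i + b i)"
proof -
  obtain K L where "\<And>i. norm (a i) \<le> K" "\<And>i. norm (b i) \<le> L"
    using assms by (metis BseqE)
  then show ?thesis
    by (intro BseqI'[of _ "K + L"]) (meson add_mono norm_triangle_ineq order_trans)
qed

lemma Bseq_cmult:
  fixes a :: "nat \<Rightarrow> real"
  assumes "Bseq a" shows "Bseq (\<lambda>i. c * a i)"
proof -
  obtain K where "\<And>i. norm (a i) \<le> K"
    using assms by (metis BseqE)
  then show ?thesis
    by (intro BseqI'[of _ "\<bar>c\<bar> * K"]) (simp add: abs_mult mult_left_mono)
qed

lemma Bseq_comp:
  fixes a :: "nat \<Rightarrow> real"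
  assumes "Bseq a" shows "Bseq (\<lambda>i. a (\<rho> i))"
  using assms by (metis BseqE BseqI')

lemma Bseq_const: "Bseq (\<lambda>_. c :: real)"
  by (rule BseqI'[of _ "\<bar>c\<bar>"]) simp

lemma mean_add: "is_mean \<Phi> \<Longrightarrow> Bseq a \<Longrightarrow> Bseq b \<Longrightarrow> \<Phi> (\<lambda>i. a i + b i) = \<Phi> a + \<Phi> b"
  and mean_cmult: "is_mean \<Phi> \<Longrightarrow> Bseq a \<Longrightarrow> \<Phi> (\<lambda>i. c * a i) = c * \<Phi> a"
  and mean_nonneg: "is_mean \<Phi> \<Longrightarrow> Bseq a \<Longrightarrow> (\<And>i. 0 \<le> a i) \<Longrightarrow> 0 \<le> \<Phi> a"
  and mean_one: "is_mean \<Phi> \<Longrightarrow> \<Phi> (\<lambda>_. 1) = 1"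
  by (simp_all add: is_mean_def)

lemma mean_mono:
  assumes "is_mean \<Phi>" "Bseq a" "Bseq b" "\<And>i. a i \<le> b i"
  shows "\<Phi> a \<le> \<Phi> b"
proof -
  have "\<Phi> (\<lambda>i. b i + (-1) * a i) = \<Phi> b + (-1) * \<Phi> a"
    using mean_add[OF assms(1,3) Bseq_cmult[OF assms(2)]] mean_cmult[OF assms(1,2)] by metis
  moreover have "0 \<le> \<Phi> (\<lambda>i. b i + (-1) * a i)"
    by (rule mean_nonneg[OF assms(1) Bseq_plus[OF assms(3) Bseq_cmult[OF assms(2)]]])
      (simp add: assms(4))
  ultimately show ?thesis by simp
qed

lemma mean_const: "is_mean \<Phi> \<Longrightarrow> \<Phi> (\<lambda>_. c) = c"
  using mean_cmult[of \<Phi> "\<lambda>_. 1" c] by (simp add: mean_one Bseq_const)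

lemma mean_abs_le:
  assumes "is_mean \<Phi>" "\<And>i. \<bar>a i\<bar> \<le> K"
  shows "\<bar>\<Phi> a\<bar> \<le> K"
proof -
  have "Bseq a" using assms(2) by (intro BseqI'[of _ K]) simp
  moreover have "a i \<le> K" "- K \<le> a i" for i
    using assms(2)[of i] by linarith+
  ultimately have "\<Phi> a \<le> \<Phi> (\<lambda>_. K)" "\<Phi> (\<lambda>_. - K) \<le> \<Phi> a"
    using mean_mono[OF assms(1) _ Bseq_const] mean_mono[OF assms(1) Bseq_const] by simp_all
  then show ?thesis using assms(1) by (simp add: mean_const)
qed

text \<open>
  A mean along \<open>S\<close> sees a sequence only through its values at arbitrarily large elements of \<open>S\<close>.
  It takes the place of a limit over these \<open>N\<close>.
\<close>

definition mean_along :: "nat set \<Rightarrow> ((nat \<Rightarrow> real) \<Rightarrow> real) \<Rightarrow> bool"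
  where "mean_along S \<Lambda> \<longleftrightarrow> is_mean \<Lambda> \<and>
    (\<forall>a B. Bseq a \<longrightarrow> (\<forall>\<^sub>F N in sequentially. N \<in> S \<longrightarrow> a N \<le> B) \<longrightarrow> \<Lambda> a \<le> B)"

lemma mean_alongD:
  "mean_along S \<Lambda> \<Longrightarrow> Bseq a \<Longrightarrow> \<forall>\<^sub>F N in sequentially. N \<in> S \<longrightarrow> a N \<le> B \<Longrightarrow> \<Lambda> a \<le> B"
  unfolding mean_along_def by blast

text \<open>
  The evaluations \<open>a \<mapsto> a N\<close> lie in a product of compact intervals, which is compact by Tychonoff's
  theorem. They cluster, as \<open>N\<close> runs through \<open>S\<close>, at a functional with the required properties.
\<close>

lemma mean_along_exists:
  assumes "infinite S"
  obtains \<Lambda> where "mean_along S \<Lambda>"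
proof -
  \<comment> \<open>The value 0 at unbounded sequences keeps all evaluations inside the product.\<close>
  define bd :: "(nat \<Rightarrow> real) \<Rightarrow> real" where "bd a = (if Bseq a then (SUP i. \<bar>a i\<bar>) else 0)" for a
  define ev :: "nat \<Rightarrow> (nat \<Rightarrow> real) \<Rightarrow> real" where "ev N a = (if Bseq a then a N else 0)" for N a
  define F where "F = filtermap ev (inf sequentially (principal S))"
  let ?K = "PiE UNIV (\<lambda>a. {- bd a .. bd a})"
  have "compactin (product_topology (\<lambda>_. euclidean) UNIV) ?K"
    by (subst compactin_PiE) simp
  then have K: "compact ?K"
    by (simp add: euclidean_product_topology)
  have ev_K: "ev N \<in> ?K" for N
  proof -
    have "\<bar>a N\<bar> \<le> (SUP i. \<bar>a i\<bar>)" if "Bseq a" for a :: "nat \<Rightarrow> real"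
      using that by (intro cSUP_upper) (auto simp: Bseq_def bdd_above_def)
    then have "\<bar>ev N a\<bar> \<le> bd a" for a by (simp add: ev_def bd_def)
    then have "ev N a \<in> {- bd a .. bd a}" for a by (simp add: abs_le_iff minus_le_iff)
    then show ?thesis by blast
  qed
  have "F \<noteq> bot"
  proof -
    have "\<not> (\<forall>\<^sub>F N in sequentially. N \<notin> S)"
      using assms by (auto simp: eventually_sequentially infinite_nat_iff_unbounded_le)
    then show ?thesis
      unfolding F_def trivial_limit_def eventually_filtermap eventually_inf_principal by simp
  qed
  moreover have "\<forall>\<^sub>F \<phi> in F. \<phi> \<in> ?K"
    unfolding F_def eventually_filtermap using ev_K by (rule always_eventually[OF allI])
  ultimately obtain \<Lambda> where \<Lambda>: "inf (nhds \<Lambda>) F \<noteq> bot"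
    using K unfolding compact_filter by blast
  \<comment> \<open>A cluster point inherits every closed condition that holds eventually along the filter.\<close>
  have closedD: "\<Lambda> \<in> C" if "closed C" "\<forall>\<^sub>F N in sequentially. N \<in> S \<longrightarrow> ev N \<in> C" for C
  proof (rule ccontr)
    assume "\<Lambda> \<notin> C"
    then have "\<forall>\<^sub>F \<phi> in nhds \<Lambda>. \<phi> \<in> - C"
      using that(1) by (intro eventually_nhds_in_open) auto
    moreover have "\<forall>\<^sub>F \<phi> in F. \<phi> \<in> C"
      using that(2) by (simp add: F_def eventually_filtermap eventually_inf_principal)
    ultimately have "\<forall>\<^sub>F \<phi> in inf (nhds \<Lambda>) F. False"
      unfolding eventually_inf by (metis ComplD)
    then show False using \<Lambda> by (simp add: trivial_limit_def)
  qed
  have cont: "continuous_on UNIV (\<lambda>\<phi> :: (nat \<Rightarrow> real) \<Rightarrow> real. \<phi> a)" for a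
    by (rule continuous_on_product_coordinates)
  have "\<Lambda> (\<lambda>i. a i + b i) = \<Lambda> a + \<Lambda> b" if "Bseq a" "Bseq b" for a b
    using closedD[of "{\<phi>. \<phi> (\<lambda>i. a i + b i) = \<phi> a + \<phi> b}", OF closed_Collect_eq] that
    by (simp add: ev_def Bseq_plus cont continuous_on_add)
  moreover have "\<Lambda> (\<lambda>i. c * a i) = c * \<Lambda> a" if "Bseq a" for a c
    using closedD[of "{\<phi>. \<phi> (\<lambda>i. c * a i) = c * \<phi> a}", OF closed_Collect_eq] that
    by (simp add: ev_def Bseq_cmult cont continuous_on_mult_left)
  moreover have "0 \<le> \<Lambda> a" if "Bseq a" "\<forall>i. 0 \<le> a i" for a
    using closedD[of "{\<phi>. 0 \<le> \<phi> a}", OF closed_Collect_le] that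
    by (simp add: ev_def cont)
  moreover have "\<Lambda> (\<lambda>_. 1) = 1"
    using closedD[of "{\<phi>. \<phi> (\<lambda>_. 1) = 1}", OF closed_Collect_eq]
    by (simp add: ev_def Bseq_const cont)
  moreover have "\<Lambda> a \<le> B" if "Bseq a" "\<forall>\<^sub>F N in sequentially. N \<in> S \<longrightarrow> a N \<le> B" for a B
    using closedD[of "{\<phi>. \<phi> a \<le> B}", OF closed_Collect_le] that
    by (simp add: ev_def cont)
  ultimately have "mean_along S \<Lambda>"
    unfolding mean_along_def is_mean_def by blast
  then show thesis by (rule that)
qed

text \<open>
  Two ways to enlarge the index set. In \<open>pair_mean\<close> the index codes a pair \<open>(i, N)\<close>, first averaged over
  \<open>i\<close> and then over \<open>N\<close>. In \<open>window_mean\<close> it codes a pair \<open>(k, m)\<close>, where \<open>k\<close> itself codes a pair \<open>(i, N)\<close> and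
  \<open>m\<close> runs over a window of length \<open>N + 1\<close>; with \<open>N\<close> instead, the window of \<open>N = 0\<close> would be empty and the
  constant sequence 1 would not be averaged to 1.
\<close>

definition pair_mean :: "((nat \<Rightarrow> real) \<Rightarrow> real) \<Rightarrow> ((nat \<Rightarrow> real) \<Rightarrow> real) \<Rightarrow> (nat \<Rightarrow> real) \<Rightarrow> real"
  where "pair_mean \<Lambda> \<Phi> b = \<Lambda> (\<lambda>N. \<Phi> (\<lambda>i. b (prod_encode (i, N))))"

definition window_mean :: "((nat \<Rightarrow> real) \<Rightarrow> real) \<Rightarrow> (nat \<Rightarrow> real) \<Rightarrow> real"
  where "window_mean \<Psi> b = \<Psi> (\<lambda>k. let N = Suc (snd (prod_decode k)) in
    (\<Sum>m = 1..N. b (prod_encode (k, m))) / real N)"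

lemma avg_abs_le:
  fixes b :: "nat \<Rightarrow> real"
  assumes "\<And>m. \<bar>b m\<bar> \<le> K"
  shows "\<bar>(\<Sum>m = 1..Suc N. b m) / real (Suc N)\<bar> \<le> K"
proof -
  have "\<bar>\<Sum>m = 1..Suc N. b m\<bar> \<le> (\<Sum>m = 1..Suc N. K)"
    by (rule order_trans[OF sum_abs sum_mono]) (rule assms)
  also have "\<dots> = K * real (Suc N)"
    by simp
  finally show ?thesis
    by (simp only: abs_divide abs_of_nat pos_divide_le_eq of_nat_0_less_iff zero_less_Suc)
qed

lemma Bseq_bound: "Bseq a \<Longrightarrow> \<exists>K. \<forall>i. \<bar>a i\<bar> \<le> (K :: real)"
  by (metis BseqE real_norm_def)

lemma Bseq_slice_mean:
  assumes "is_mean \<Phi>" "Bseq b"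
  shows "Bseq (\<lambda>N. \<Phi> (\<lambda>i. b (prod_encode (i, N))))"
  using Bseq_bound[OF assms(2)] assms(1) by (metis BseqI' mean_abs_le real_norm_def)

lemma is_mean_pair_mean:
  assumes \<Lambda>: "is_mean \<Lambda>" and \<Phi>: "is_mean \<Phi>"
  shows "is_mean (pair_mean \<Lambda> \<Phi>)"
proof -
  have "pair_mean \<Lambda> \<Phi> (\<lambda>i. a i + b i) = pair_mean \<Lambda> \<Phi> a + pair_mean \<Lambda> \<Phi> b"
    if "Bseq a" "Bseq b" for a b
    unfolding pair_mean_def mean_add[OF \<Phi> Bseq_comp[OF that(1)] Bseq_comp[OF that(2)]]
    by (intro mean_add[OF \<Lambda>] Bseq_slice_mean[OF \<Phi>] that)
  moreover have "pair_mean \<Lambda> \<Phi> (\<lambda>i. c * a i) = c * pair_mean \<Lambda> \<Phi> a" if "Bseq a" for a c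
    unfolding pair_mean_def mean_cmult[OF \<Phi> Bseq_comp[OF that]]
    by (intro mean_cmult[OF \<Lambda>] Bseq_slice_mean[OF \<Phi>] that)
  moreover have "0 \<le> pair_mean \<Lambda> \<Phi> a" if "Bseq a" "\<forall>i. 0 \<le> a i" for a
    unfolding pair_mean_def using that(2)
    by (intro mean_nonneg[OF \<Lambda> Bseq_slice_mean[OF \<Phi> that(1)]] mean_nonneg[OF \<Phi> Bseq_comp[OF that(1)]]) simp
  moreover have "pair_mean \<Lambda> \<Phi> (\<lambda>_. 1) = 1"
    by (simp add: pair_mean_def mean_one \<Lambda> \<Phi>)
  ultimately show ?thesis unfolding is_mean_def by blast
qed

lemma pair_mean_fst:
  assumes "is_mean \<Lambda>"
  shows "pair_mean \<Lambda> \<Phi> (\<lambda>k. a (fst (prod_decode k))) = \<Phi> a"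
  using assms by (simp add: pair_mean_def mean_const)

lemma Bseq_window:
  assumes "Bseq b"
  shows "Bseq (\<lambda>k. let N = Suc (snd (prod_decode k)) in
    (\<Sum>m = 1..N. b (prod_encode (k, m))) / real N)"
proof -
  obtain K where "\<And>i. \<bar>b i\<bar> \<le> K" using Bseq_bound[OF assms] by blast
  then show ?thesis
    unfolding Let_def by (intro BseqI'[of _ K]) (simp only: real_norm_def avg_abs_le)
qed

lemma is_mean_window_mean:
  assumes \<Psi>: "is_mean \<Psi>"
  shows "is_mean (window_mean \<Psi>)"
proof -
  have "window_mean \<Psi> (\<lambda>i. a i + b i) = window_mean \<Psi> a + window_mean \<Psi> b"
    if "Bseq a" "Bseq b" for a b
    using mean_add[OF \<Psi> Bseq_window[OF that(1)] Bseq_window[OF that(2)]]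
    by (simp add: window_mean_def Let_def sum.distrib add_divide_distrib del: sum.cl_ivl_Suc)
  moreover have "window_mean \<Psi> (\<lambda>i. c * a i) = c * window_mean \<Psi> a" if "Bseq a" for a c
    using mean_cmult[OF \<Psi> Bseq_window[OF that]]
    by (simp add: window_mean_def Let_def sum_distrib_left[symmetric] del: sum.cl_ivl_Suc)
  moreover have "0 \<le> window_mean \<Psi> a" if "Bseq a" "\<forall>i. 0 \<le> a i" for a
    unfolding window_mean_def using that
    by (intro mean_nonneg[OF \<Psi> Bseq_window[OF that(1)]])
      (auto simp: Let_def intro!: divide_nonneg_nonneg sum_nonneg simp del: sum.cl_ivl_Suc)
  moreover have "window_mean \<Psi> (\<lambda>_. 1) = 1"
    by (simp add: window_mean_def Let_def mean_one[OF \<Psi>])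
  ultimately show ?thesis unfolding is_mean_def by blast
qed

section \<open>Cesaro averages of complex numbers\<close>

definition cesaro :: "nat \<Rightarrow> (nat \<Rightarrow> complex) \<Rightarrow> complex"
  where "cesaro N z = (1 / of_nat N) * (\<Sum>n = 1..N. z n)"

lemma cesaro_cong: "(\<And>n. z n = w n) \<Longrightarrow> cesaro N z = cesaro N w"
  by (simp add: cesaro_def)

lemma cesaro_add: "cesaro N (\<lambda>n. z n + w n) = cesaro N z + cesaro N w"
  by (simp add: cesaro_def sum.distrib distrib_left)

lemma cesaro_diff: "cesaro N (\<lambda>n. z n - w n) = cesaro N z - cesaro N w"
  by (simp add: cesaro_def sum_subtractf right_diff_distrib)

lemma cesaro_mult_left: "cesaro N (\<lambda>n. c * z n) = c * cesaro N z"
  by (simp add: cesaro_def sum_distrib_left[symmetric])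

lemma cesaro_cnj: "cnj (cesaro N z) = cesaro N (\<lambda>n. cnj (z n))"
  by (simp add: cesaro_def)

lemma cesaro_const: "N \<ge> 1 \<Longrightarrow> cesaro N (\<lambda>_. c) = c"
  by (simp add: cesaro_def)

lemma cesaro_swap:
  "cesaro N (\<lambda>m. cesaro K (\<lambda>n. w m n)) = cesaro K (\<lambda>n. cesaro N (\<lambda>m. w m n))"
proof -
  have "(\<Sum>m = 1..N. \<Sum>n = 1..K. w m n) = (\<Sum>n = 1..K. \<Sum>m = 1..N. w m n)"
    by (rule sum.swap)
  then show ?thesis
    by (simp add: cesaro_def sum_divide_distrib[symmetric] mult.commute)
qed

text \<open>
  The empty average is 0, and the hypothesis at \<open>n = 0\<close> makes \<open>K\<close> nonnegative.
\<close>

lemma cesaro_bound: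
  assumes "\<And>n. n \<le> N \<Longrightarrow> cmod (z n) \<le> K"
  shows "cmod (cesaro N z) \<le> K"
proof (cases "N = 0")
  case True
  then show ?thesis
    using order_trans[OF norm_ge_zero assms[of 0]] by (simp add: cesaro_def)
next
  case False
  have "cmod (\<Sum>n = 1..N. z n) \<le> (\<Sum>n = 1..N. K)"
    by (rule sum_norm_le) (simp add: assms)
  also have "\<dots> = K * real N" by simp
  finally show ?thesis
    using False by (simp add: cesaro_def norm_mult norm_divide pos_divide_le_eq)
qed

lemma cesaro_square:
  "(cmod (cesaro N z))\<^sup>2 \<le> (\<Sum>n = 1..N. (cmod (z n))\<^sup>2) / real N"
proof (cases "N = 0")
  case False
  have "(cmod (\<Sum>n = 1..N. z n))\<^sup>2 \<le> (\<Sum>n = 1..N. cmod (z n))\<^sup>2"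
    by (intro power_mono norm_sum) simp
  also have "\<dots> \<le> (\<Sum>n = 1..N. (cmod (z n))\<^sup>2) * real N"
    using sum_squared_le_sum_of_squares[of "\<lambda>n. cmod (z n)" "{1..N}"] by simp
  finally show ?thesis
    using False
    by (simp add: cesaro_def norm_mult norm_divide power_divide field_simps power2_eq_square)
qed (simp add: cesaro_def)

text \<open>The two sums differ in at most \<open>2 l\<close> terms.\<close>

lemma cesaro_shift:
  assumes "\<And>m. cmod (w m) \<le> B"
  shows "cmod (cesaro N w - cesaro N (\<lambda>m. w (l + m))) \<le> 2 * real l * B / real N"
proof -
  have "cmod ((\<Sum>m = 1..N. w m) - (\<Sum>m = 1..N. w (l + m))) \<le> 2 * real l * B"
  proof (induction l)
    case (Suc l)
    have "(\<Sum>m = 1..N. w (Suc l + m)) + w (l + 1) = (\<Sum>m = 1..N. w (l + m)) + w (l + Suc N)"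
      by (induction N) (simp_all add: algebra_simps)
    then have "(\<Sum>m = 1..N. w m) - (\<Sum>m = 1..N. w (Suc l + m)) =
        ((\<Sum>m = 1..N. w m) - (\<Sum>m = 1..N. w (l + m))) + (w (l + 1) - w (l + Suc N))"
      by (simp add: algebra_simps)
    also have "cmod \<dots> \<le> 2 * real l * B + (B + B)"
      by (intro norm_triangle_mono Suc.IH norm_triangle_le_diff add_mono assms)
    finally show ?case by (simp add: algebra_simps)
  qed simp
  then show ?thesis
    by (simp add: cesaro_def diff_divide_distrib[symmetric] norm_divide divide_right_mono)
qed

section \<open>Bounded families of functions on a measure-preserving action\<close>

locale pmp_action = group G + prob_space M
  for G :: "('g, 'b) monoid_scheme" (structure) and M :: "'x measure" +
  fixes T :: "'g \<Rightarrow> 'x \<Rightarrow> 'x"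
  assumes space_UNIV: "space M = UNIV"
    and T_measurable: "g \<in> carrier G \<Longrightarrow> T g \<in> measurable M M"
    and T_distr: "g \<in> carrier G \<Longrightarrow> distr M M (T g) = M"
    and T_mult: "g \<in> carrier G \<Longrightarrow> h \<in> carrier G \<Longrightarrow> T (g \<otimes> h) x = T g (T h x)"
    and T_one: "T \<one> x = x"
begin

lemma T_inv_T: "g \<in> carrier G \<Longrightarrow> T (inv g) (T g x) = x"
  by (simp add: T_mult[symmetric] T_one)

lemma integral_T:
  fixes f :: "'x \<Rightarrow> 'c :: {banach, second_countable_topology}"
  assumes "g \<in> carrier G" "f \<in> borel_measurable M"
  shows "(\<integral>x. f (T g x) \<partial>M) = (\<integral>x. f x \<partial>M)"
  using integral_distr[OF T_measurable[OF assms(1)] assms(2)] T_distr[OF assms(1)] by simp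

text \<open>
  The bound is common to all members of the family, so that a mean can be applied to their integrals.
\<close>

definition bfam :: "('i \<Rightarrow> 'x \<Rightarrow> complex) \<Rightarrow> bool"
  where "bfam F \<longleftrightarrow> (\<forall>i. F i \<in> borel_measurable M) \<and> (\<exists>C. \<forall>i x. cmod (F i x) \<le> C)"

lemma bfamI:
  "(\<And>i. F i \<in> borel_measurable M) \<Longrightarrow> (\<And>i x. cmod (F i x) \<le> C) \<Longrightarrow> bfam F"
  unfolding bfam_def by blast

lemma bfam_bound:
  assumes "bfam F"
  obtains C where "C \<ge> 1" "\<And>i x. cmod (F i x) \<le> C"
proof -
  obtain C where "\<And>i x. cmod (F i x) \<le> C" using assms unfolding bfam_def by blast
  then show thesis by (intro that[of "max 1 C"]) (auto intro: order_trans max.cobounded2)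
qed

lemma bfam_measurable: "bfam F \<Longrightarrow> F i \<in> borel_measurable M"
  by (simp add: bfam_def)

lemma bfam_reindex: "bfam F \<Longrightarrow> bfam (\<lambda>k. F (\<rho> k))"
  unfolding bfam_def by blast

lemma bfam_const: "bfam (\<lambda>_ _. c)"
  by (rule bfamI) auto

lemma bfam_add:
  assumes "bfam F" "bfam H" shows "bfam (\<lambda>i x. F i x + H i x)"
proof -
  obtain C D where "\<And>i x. cmod (F i x) \<le> C" "\<And>i x. cmod (H i x) \<le> D"
    using assms unfolding bfam_def by blast
  then show ?thesis
    using assms by (intro bfamI[of _ "C + D"])
      (simp_all add: borel_measurable_add bfam_measurable norm_triangle_mono)
qed

lemma bfam_mult:
  assumes "bfam F" "bfam H" shows "bfam (\<lambda>i x. F i x * H i x)"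
proof -
  obtain C D where CD: "\<And>i x. cmod (F i x) \<le> C" "\<And>i x. cmod (H i x) \<le> D"
    using assms unfolding bfam_def by blast
  have "0 \<le> C" using CD(1) norm_ge_zero order_trans by blast
  then show ?thesis
    using assms CD by (intro bfamI[of _ "C * D"])
      (simp_all add: borel_measurable_times bfam_measurable norm_mult mult_mono)
qed

lemma bfam_diff:
  assumes "bfam F" "bfam H" shows "bfam (\<lambda>i x. F i x - H i x)"
  using bfam_add[OF assms(1) bfam_mult[OF bfam_const[of "-1"] assms(2)]] by simp

lemma bfam_cnj:
  assumes "bfam F" shows "bfam (\<lambda>i x. cnj (F i x))"
proof -
  have "(\<lambda>x. cnj (F i x)) \<in> borel_measurable M" for i
    by (intro borel_measurable_continuous_on[OF _ bfam_measurable[OF assms]] continuous_intros)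
  then show ?thesis
    using assms unfolding bfam_def by simp
qed

lemma bfam_T:
  assumes "bfam F" "\<And>i. g i \<in> carrier G"
  shows "bfam (\<lambda>i x. F i (T (g i) x))"
proof -
  have "(\<lambda>x. F i (T (g i) x)) \<in> borel_measurable M" for i
    using measurable_compose[OF T_measurable[OF assms(2)] bfam_measurable[OF assms(1)]] .
  then show ?thesis
    using assms(1) unfolding bfam_def by blast
qed

lemma bfam_prod_list:
  assumes "\<And>a. a \<in> set L \<Longrightarrow> bfam (F a)"
  shows "bfam (\<lambda>i x. \<Prod>a\<leftarrow>L. F a i x)"
  using assms by (induction L) (auto intro: bfam_const bfam_mult)

lemma cesaro_measurable:
  "(\<And>n. f n \<in> borel_measurable M) \<Longrightarrow> (\<lambda>x. cesaro N (\<lambda>n. f n x)) \<in> borel_measurable M"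
  unfolding cesaro_def by measurable

text \<open>
  The summands are indexed by pairs, so that one bound serves all \<open>n\<close> and \<open>i\<close>. Hence the lengths of the
  averages may depend on \<open>i\<close> without any restriction.
\<close>

lemma bfam_cesaro:
  assumes "bfam (\<lambda>a x. W (fst a) (snd a) x)"
  shows "bfam (\<lambda>i x. cesaro (N i) (\<lambda>n. W n i x))"
proof -
  obtain C where "\<And>a x. cmod (W (fst a) (snd a) x) \<le> C"
    using assms unfolding bfam_def by blast
  then have "cmod (W n i x) \<le> C" for n i x by (metis fst_conv snd_conv)
  moreover have "W n i \<in> borel_measurable M" for n i
    using bfam_measurable[OF assms, of "(n, i)"] by simp
  ultimately show ?thesis
    by (intro bfamI[of _ C]) (auto intro!: cesaro_measurable cesaro_bound)
qed

definition msq :: "('x \<Rightarrow> complex) \<Rightarrow> real"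
  where "msq f = (\<integral>x. (cmod (f x))\<^sup>2 \<partial>M)"

lemma bounded_integrable:
  fixes f :: "'x \<Rightarrow> 'c :: {banach, second_countable_topology}"
  assumes "f \<in> borel_measurable M" "\<And>x. norm (f x) \<le> C"
  shows "integrable M f"
  using assms by (intro integrable_const_bound[of _ C]) auto

lemma bfam_integrable:
  assumes "bfam F" shows "integrable M (F i)"
  using assms unfolding bfam_def by (auto intro: bounded_integrable)

lemma bfam_integrable_square:
  assumes "bfam F" shows "integrable M (\<lambda>x. (cmod (F i x))\<^sup>2)"
proof -
  obtain C where "\<And>i x. cmod (F i x) \<le> C" using assms unfolding bfam_def by blast
  then show ?thesis
    using bfam_measurable[OF assms]
    by (intro bounded_integrable[of _ "C\<^sup>2"]) (auto intro: power_mono)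
qed

lemma msq_nonneg: "0 \<le> msq f"
  by (simp add: msq_def)

lemma msq_bound:
  assumes "f \<in> borel_measurable M" "\<And>x. cmod (f x) \<le> C"
  shows "msq f \<le> C\<^sup>2"
proof -
  have "msq f \<le> (\<integral>x. C\<^sup>2 \<partial>M)"
    unfolding msq_def using assms
    by (intro integral_mono bounded_integrable[of _ "C\<^sup>2"]) (auto intro: power_mono)
  then show ?thesis by (simp add: prob_space)
qed

lemma Bseq_msq:
  assumes "bfam F" shows "Bseq (\<lambda>i. msq (F i))"
proof -
  obtain C where "\<And>i x. cmod (F i x) \<le> C" using assms unfolding bfam_def by blast
  then show ?thesis
    using bfam_measurable[OF assms]
    by (intro BseqI'[of _ "C\<^sup>2"]) (simp add: msq_nonneg msq_bound)
qed

lemma norm_add_square_le: "(norm (a + b))\<^sup>2 \<le> 2 * (norm a)\<^sup>2 + 2 * (norm (b :: complex))\<^sup>2"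
proof -
  have "(norm (a + b))\<^sup>2 \<le> (norm a + norm b)\<^sup>2"
    by (intro power_mono norm_triangle_ineq) simp
  also have "\<dots> \<le> 2 * (norm a)\<^sup>2 + 2 * (norm b)\<^sup>2"
    using sum_squares_bound[of "norm a" "norm b"] by (simp add: power2_sum)
  finally show ?thesis .
qed

lemma msq_add_le:
  assumes "bfam F" "bfam H"
  shows "msq (\<lambda>x. F i x + H i x) \<le> 2 * msq (F i) + 2 * msq (H i)"
proof -
  have "msq (\<lambda>x. F i x + H i x) \<le> (\<integral>x. 2 * (cmod (F i x))\<^sup>2 + 2 * (cmod (H i x))\<^sup>2 \<partial>M)"
    unfolding msq_def
    by (intro integral_mono norm_add_square_le Bochner_Integration.integrable_add
        integrable_mult_right bfam_integrable_square assms
        bfam_integrable_square[OF bfam_add[OF assms]])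
  also have "\<dots> = 2 * msq (F i) + 2 * msq (H i)"
    by (simp add: msq_def bfam_integrable_square assms)
  finally show ?thesis .
qed

lemma msq_cesaro_le:
  assumes "bfam W"
  shows "msq (\<lambda>x. cesaro N (\<lambda>n. W n x)) \<le> (\<Sum>n = 1..N. msq (W n)) / real N"
proof -
  have "bfam (\<lambda>_ :: unit. \<lambda>x. cesaro N (\<lambda>n. W n x))"
    by (rule bfam_cesaro[OF bfam_reindex[OF assms]])
  then have "msq (\<lambda>x. cesaro N (\<lambda>n. W n x)) \<le> (\<integral>x. (\<Sum>n = 1..N. (cmod (W n x))\<^sup>2) / real N \<partial>M)"
    unfolding msq_def
    by (intro integral_mono cesaro_square integrable_divide Bochner_Integration.integrable_sum
        bfam_integrable_square[OF assms]) (rule bfam_integrable_square)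
  also have "\<dots> = (\<Sum>n = 1..N. msq (W n)) / real N"
    using assms by (simp add: msq_def bfam_integrable_square)
  finally show ?thesis .
qed

lemma integral_cesaro:
  assumes "bfam W"
  shows "(\<integral>x. cesaro N (\<lambda>n. W n x) \<partial>M) = cesaro N (\<lambda>n. \<integral>x. W n x \<partial>M)"
  unfolding cesaro_def using bfam_integrable[OF assms] by simp

lemma msq_diff_expand:
  assumes "bfam F" "bfam H"
  shows "msq (\<lambda>x. F i x - of_real t * H i x) =
    msq (F i) - 2 * t * Re (\<integral>x. F i x * cnj (H i x) \<partial>M) + t\<^sup>2 * msq (H i)"
proof -
  have FH: "integrable M (\<lambda>x. F i x * cnj (H i x))"
    by (rule bfam_integrable[OF bfam_mult[OF assms(1) bfam_cnj[OF assms(2)]]])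
  have "(cmod (a - of_real t * b))\<^sup>2 = (cmod a)\<^sup>2 - 2 * t * Re (a * cnj b) + t\<^sup>2 * (cmod b)\<^sup>2"
    for a b
    unfolding cmod_power2 by (simp add: power2_eq_square algebra_simps)
  then have "msq (\<lambda>x. F i x - of_real t * H i x) =
      (\<integral>x. (cmod (F i x))\<^sup>2 - 2 * t * Re (F i x * cnj (H i x)) + t\<^sup>2 * (cmod (H i x))\<^sup>2 \<partial>M)"
    by (simp add: msq_def)
  also have "\<dots> = msq (F i) - 2 * t * (\<integral>x. Re (F i x * cnj (H i x)) \<partial>M) + t\<^sup>2 * msq (H i)"
    unfolding msq_def using FH
    by (simp add: bfam_integrable_square assms del: times_complex.sel)
  also have "(\<integral>x. Re (F i x * cnj (H i x)) \<partial>M) = Re (\<integral>x. F i x * cnj (H i x) \<partial>M)"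
    by (rule integral_Re[OF FH])
  finally show ?thesis .
qed

definition mean_msq :: "((nat \<Rightarrow> real) \<Rightarrow> real) \<Rightarrow> (nat \<Rightarrow> 'x \<Rightarrow> complex) \<Rightarrow> real"
  where "mean_msq \<Phi> F = \<Phi> (\<lambda>i. msq (F i))"

definition mean_cauchy :: "((nat \<Rightarrow> real) \<Rightarrow> real) \<Rightarrow> (nat \<Rightarrow> nat \<Rightarrow> 'x \<Rightarrow> complex) \<Rightarrow> bool"
  where "mean_cauchy \<Phi> Y \<longleftrightarrow>
    (\<forall>\<epsilon> > 0. \<exists>N\<^sub>0. \<forall>m \<ge> N\<^sub>0. \<forall>n \<ge> N\<^sub>0. mean_msq \<Phi> (\<lambda>i x. Y m i x - Y n i x) \<le> \<epsilon>)"

lemma mean_msq_nonneg: "is_mean \<Phi> \<Longrightarrow> bfam F \<Longrightarrow> 0 \<le> mean_msq \<Phi> F"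
  unfolding mean_msq_def by (rule mean_nonneg[OF _ Bseq_msq msq_nonneg])

lemma mean_msq_add_le:
  assumes "is_mean \<Phi>" "bfam F" "bfam H"
  shows "mean_msq \<Phi> (\<lambda>i x. F i x + H i x) \<le> 2 * mean_msq \<Phi> F + 2 * mean_msq \<Phi> H"
proof -
  have "mean_msq \<Phi> (\<lambda>i x. F i x + H i x) \<le> \<Phi> (\<lambda>i. 2 * msq (F i) + 2 * msq (H i))"
    unfolding mean_msq_def
    using msq_add_le[OF assms(2,3)]
    by (rule mean_mono[OF assms(1) Bseq_msq[OF bfam_add[OF assms(2,3)]]
          Bseq_plus[OF Bseq_cmult[OF Bseq_msq[OF assms(2)]] Bseq_cmult[OF Bseq_msq[OF assms(3)]]]])
  also have "\<dots> = 2 * mean_msq \<Phi> F + 2 * mean_msq \<Phi> H"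
    unfolding mean_msq_def
      mean_add[OF assms(1) Bseq_cmult[OF Bseq_msq[OF assms(2)]] Bseq_cmult[OF Bseq_msq[OF assms(3)]]]
      mean_cmult[OF assms(1) Bseq_msq[OF assms(2)]] mean_cmult[OF assms(1) Bseq_msq[OF assms(3)]] ..
  finally show ?thesis .
qed

lemma msq_cmult: "msq (\<lambda>x. c * f x) = (cmod c)\<^sup>2 * msq f"
  by (simp add: msq_def norm_mult power_mult_distrib)

lemma mean_msq_cmult:
  assumes "is_mean \<Phi>" "bfam F"
  shows "mean_msq \<Phi> (\<lambda>i x. c * F i x) = (cmod c)\<^sup>2 * mean_msq \<Phi> F"
  unfolding mean_msq_def msq_cmult by (rule mean_cmult[OF assms(1) Bseq_msq[OF assms(2)]])

lemma mean_msq_diff_le: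
  assumes "is_mean \<Phi>" "bfam F" "bfam H"
  shows "mean_msq \<Phi> (\<lambda>i x. F i x - H i x) \<le> 2 * mean_msq \<Phi> F + 2 * mean_msq \<Phi> H"
  using mean_msq_add_le[OF assms(1,2) bfam_mult[OF bfam_const[of "-1"] assms(3)]]
    mean_msq_cmult[OF assms(1,3), of "-1"] by simp

section \<open>Weighted averages and dual functions\<close>

text \<open>
  \<open>wavg g Q N u\<close> is the average \<open>A\<^sub>N u\<close> with weights \<open>Q\<close>, and \<open>dual g Q N u\<close> is what one obtains from it by
  applying the adjoint of the operator \<open>A\<^sub>N\<close>.
\<close>

definition wavg ::
    "(nat \<Rightarrow> 'i \<Rightarrow> 'g) \<Rightarrow> (nat \<Rightarrow> 'i \<Rightarrow> 'x \<Rightarrow> complex) \<Rightarrow> nat \<Rightarrow> ('i \<Rightarrow> 'x \<Rightarrow> complex) \<Rightarrow> 'i \<Rightarrow> 'x \<Rightarrow> complex"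
  where "wavg g Q N u i x = cesaro N (\<lambda>n. Q n i x * u i (T (g n i) x))"

definition dual ::
    "(nat \<Rightarrow> 'i \<Rightarrow> 'g) \<Rightarrow> (nat \<Rightarrow> 'i \<Rightarrow> 'x \<Rightarrow> complex) \<Rightarrow> nat \<Rightarrow> ('i \<Rightarrow> 'x \<Rightarrow> complex) \<Rightarrow> 'i \<Rightarrow> 'x \<Rightarrow> complex"
  where "dual g Q N u i x =
    cesaro N (\<lambda>m. wavg g Q N u i (T (inv g m i) x) * cnj (Q m i (T (inv g m i) x)))"

text \<open>
  The weights are bounded uniformly in \<open>n\<close> and in the index, which is expressed by boundedness of a
  family over pairs.
\<close>

definition weights :: "(nat \<Rightarrow> 'i \<Rightarrow> 'x \<Rightarrow> complex) \<Rightarrow> bool"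
  where "weights Q \<longleftrightarrow> bfam (\<lambda>a. Q (fst a) (snd a))"

lemma weights_bfam: "weights Q \<Longrightarrow> bfam (\<lambda>a. Q (m a) (\<rho> a))"
  unfolding weights_def using bfam_reindex[of "\<lambda>a. Q (fst a) (snd a)" "\<lambda>a. (m a, \<rho> a)"] by simp

lemma weights_reindex: "weights Q \<Longrightarrow> weights (\<lambda>n k. Q n (\<rho> k))"
  unfolding weights_def by (rule weights_bfam) (simp add: weights_def)

lemma bfam_wavg_gen:
  assumes "weights Q" "\<And>n i. g n i \<in> carrier G" "bfam u"
  shows "bfam (\<lambda>a. wavg g Q (N a) u (\<rho> a))"
  unfolding wavg_def
  by (intro bfam_cesaro bfam_mult bfam_T[OF bfam_reindex[OF assms(3)]] weights_bfam assms)

lemma bfam_dual_gen: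
  assumes "weights Q" "\<And>n i. g n i \<in> carrier G" "bfam u"
  shows "bfam (\<lambda>a. dual g Q (N a) u (\<rho> a))"
proof -
  have "bfam (\<lambda>a x. wavg g Q (N (snd a)) u (\<rho> (snd a)) (T (inv g (fst a) (\<rho> (snd a))) x))"
    "bfam (\<lambda>a x. cnj (Q (fst a) (\<rho> (snd a)) (T (inv g (fst a) (\<rho> (snd a))) x)))"
    by (intro bfam_cnj bfam_T[OF weights_bfam[OF assms(1)]] bfam_T[OF bfam_wavg_gen[OF assms]]
        inv_closed assms(2))+
  then show ?thesis
    unfolding dual_def by (intro bfam_cesaro bfam_mult) auto
qed

text \<open>
  As the dual function is the adjoint of \<open>A\<^sub>N\<close> applied to \<open>A\<^sub>N u\<close>, its inner product with \<open>u\<close> is that of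
  \<open>A\<^sub>N u\<close> with itself. The substitution \<open>x \<mapsto> T (g m i) x\<close>, which preserves the measure, moves the
  operator from one side to the other.
\<close>

lemma dual_inner:
  assumes "weights Q" "\<And>n i. g n i \<in> carrier G" "bfam u"
  shows "(\<integral>x. u i x * cnj (dual g Q N u i x) \<partial>M) = of_real (msq (wavg g Q N u i))"
proof -
  let ?A = "wavg g Q N u i"
  let ?W = "\<lambda>m x. cnj (?A (T (inv g m i) x)) * Q m i (T (inv g m i) x)"
  have A: "bfam (\<lambda>_ :: nat. ?A)" by (rule bfam_wavg_gen[OF assms])
  have u: "bfam (\<lambda>_ :: nat. u i)" by (rule bfam_reindex[OF assms(3)])
  have Q: "bfam (\<lambda>m. Q m i)" by (rule weights_bfam[OF assms(1)])
  have W: "bfam ?W"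
    by (intro bfam_mult bfam_T[OF Q] bfam_T[OF bfam_cnj[OF A]] inv_closed assms(2))
  have V: "bfam (\<lambda>m x. cnj (?A x) * (Q m i x * u i (T (g m i) x)))"
    by (intro bfam_mult bfam_cnj A Q bfam_T[OF u] assms(2))
  have "(\<integral>x. u i x * cnj (dual g Q N u i x) \<partial>M) = (\<integral>x. cesaro N (\<lambda>m. u i x * ?W m x) \<partial>M)"
    by (simp add: dual_def cesaro_cnj cesaro_mult_left)
  also have "\<dots> = cesaro N (\<lambda>m. \<integral>x. u i x * ?W m x \<partial>M)"
    by (rule integral_cesaro[OF bfam_mult[OF u W]])
  also have "\<dots> = cesaro N (\<lambda>m. \<integral>x. cnj (?A x) * (Q m i x * u i (T (g m i) x)) \<partial>M)"
  proof (rule cesaro_cong)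
    fix m
    have "(\<integral>x. u i x * ?W m x \<partial>M) = (\<integral>x. u i (T (g m i) x) * ?W m (T (g m i) x) \<partial>M)"
      by (rule integral_T[symmetric, OF assms(2) bfam_measurable[OF bfam_mult[OF u W]]])
    also have "\<dots> = (\<integral>x. cnj (?A x) * (Q m i x * u i (T (g m i) x)) \<partial>M)"
      by (simp add: T_inv_T assms(2) ac_simps)
    finally show "(\<integral>x. u i x * ?W m x \<partial>M) = \<dots>" .
  qed
  also have "\<dots> = (\<integral>x. cesaro N (\<lambda>m. cnj (?A x) * (Q m i x * u i (T (g m i) x))) \<partial>M)"
    by (rule integral_cesaro[symmetric, OF V])
  also have "\<dots> = (\<integral>x. cnj (?A x) * ?A x \<partial>M)"
    by (simp add: wavg_def cesaro_mult_left)
  also have "\<dots> = (\<integral>x. complex_of_real ((cmod (?A x))\<^sup>2) \<partial>M)"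
    by (rule Bochner_Integration.integral_cong) (simp_all only: complex_norm_square mult.commute)
  also have "\<dots> = of_real (msq ?A)"
    by (simp add: msq_def del: of_real_power)
  finally show ?thesis .
qed

text \<open>
  The dual function is bounded in the mean square by \<open>A\<^sub>N u\<close> with a constant that depends on the
  weights only. A bound through the supremum norm of \<open>u\<close> would be useless, because \<open>u\<close> will be the
  error of a best approximation, whose supremum norm is not under control.
\<close>

lemma msq_dual_le:
  assumes "weights Q" "\<And>n i. g n i \<in> carrier G" "bfam u" "\<And>n i x. cmod (Q n i x) \<le> C"
  shows "msq (dual g Q N u i) \<le> C\<^sup>2 * msq (wavg g Q N u i)"
proof -
  let ?A = "wavg g Q N u i"
  let ?W = "\<lambda>m x. ?A (T (inv g m i) x) * cnj (Q m i (T (inv g m i) x))"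
  have A: "bfam (\<lambda>_ :: nat. ?A)" by (rule bfam_wavg_gen[OF assms(1-3)])
  have Q: "bfam (\<lambda>m. Q m i)" by (rule weights_bfam[OF assms(1)])
  have W: "bfam ?W"
    by (intro bfam_mult bfam_T[OF bfam_cnj[OF Q]] bfam_T[OF A] inv_closed assms(2))
  have "msq (?W m) \<le> C\<^sup>2 * msq ?A" for m
  proof -
    have "msq (?W m) \<le> (\<integral>x. C\<^sup>2 * (cmod (?A (T (inv g m i) x)))\<^sup>2 \<partial>M)"
      unfolding msq_def
    proof (rule integral_mono)
      show "integrable M (\<lambda>x. (cmod (?W m x))\<^sup>2)"
        by (rule bfam_integrable_square[OF W])
      show "integrable M (\<lambda>x. C\<^sup>2 * (cmod (?A (T (inv g m i) x)))\<^sup>2)"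
        by (intro integrable_mult_right bfam_integrable_square[OF bfam_T[OF A]] inv_closed assms(2))
      show "(cmod (?W m x))\<^sup>2 \<le> C\<^sup>2 * (cmod (?A (T (inv g m i) x)))\<^sup>2" for x
        using power_mono[OF assms(4)[of m i "T (inv g m i) x"] norm_ge_zero, of 2]
        by (simp add: norm_mult power_mult_distrib mult.commute mult_right_mono)
    qed
    also have "\<dots> = C\<^sup>2 * (\<integral>x. (cmod (?A (T (inv g m i) x)))\<^sup>2 \<partial>M)"
      by simp
    also have "\<dots> = C\<^sup>2 * msq ?A"
      unfolding msq_def
      using integral_T[OF inv_closed[OF assms(2)], of "\<lambda>x. (cmod (?A x))\<^sup>2"] bfam_measurable[OF A]
      by simp
    finally show ?thesis .
  qed
  then have "(\<Sum>m = 1..N. msq (?W m)) / real N \<le> (\<Sum>m = 1..N. C\<^sup>2 * msq ?A) / real N"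
    by (intro divide_right_mono sum_mono) auto
  also have "\<dots> \<le> C\<^sup>2 * msq ?A"
    by (simp add: msq_nonneg)
  finally show ?thesis
    using msq_cesaro_le[OF W, of N] unfolding dual_def by linarith
qed


section \<open>Best approximation over all extensions\<close>

lemma wavg_reindex:
  "wavg (\<lambda>n k. g n (\<rho> k)) (\<lambda>n k. Q n (\<rho> k)) N (\<lambda>k. u (\<rho> k)) k = wavg g Q N u (\<rho> k)"
  by (simp add: wavg_def fun_eq_iff)

lemma wavg_add: "wavg g Q N (\<lambda>i x. u i x + v i x) i x = wavg g Q N u i x + wavg g Q N v i x"
  by (simp add: wavg_def distrib_left cesaro_add)

lemma wavg_cmult: "wavg g Q N (\<lambda>i x. c * u i x) i x = c * wavg g Q N u i x"
  by (simp add: wavg_def cesaro_mult_left[symmetric] ac_simps)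

lemma bfam_wavg:
  "weights Q \<Longrightarrow> (\<And>n i. g n i \<in> carrier G) \<Longrightarrow> bfam u \<Longrightarrow> bfam (wavg g Q N u)"
  by (rule bfam_wavg_gen[where \<rho> = "\<lambda>a. a"])

lemma mean_cauchyD:
  assumes "mean_cauchy \<Phi> Y" "\<epsilon> > 0"
  obtains N\<^sub>0 where "\<And>m n. m \<ge> N\<^sub>0 \<Longrightarrow> n \<ge> N\<^sub>0 \<Longrightarrow> mean_msq \<Phi> (\<lambda>i x. Y m i x - Y n i x) \<le> \<epsilon>"
  using assms unfolding mean_cauchy_def by blast

lemma mean_cauchy_add:
  assumes "is_mean \<Phi>" "\<And>n. bfam (Y n)" "\<And>n. bfam (Z n)" "mean_cauchy \<Phi> Y" "mean_cauchy \<Phi> Z"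
  shows "mean_cauchy \<Phi> (\<lambda>n i x. Y n i x + Z n i x)"
  unfolding mean_cauchy_def
proof (intro allI impI)
  fix \<epsilon> :: real assume "\<epsilon> > 0"
  then have "\<epsilon> / 4 > 0" by simp
  obtain K where K: "mean_msq \<Phi> (\<lambda>i x. Y m i x - Y n i x) \<le> \<epsilon> / 4" if "m \<ge> K" "n \<ge> K" for m n
    by (rule mean_cauchyD[OF assms(4) \<open>\<epsilon> / 4 > 0\<close>]) blast
  obtain L where L: "mean_msq \<Phi> (\<lambda>i x. Z m i x - Z n i x) \<le> \<epsilon> / 4" if "m \<ge> L" "n \<ge> L" for m n
    by (rule mean_cauchyD[OF assms(5) \<open>\<epsilon> / 4 > 0\<close>]) blast
  have "mean_msq \<Phi> (\<lambda>i x. (Y m i x + Z m i x) - (Y n i x + Z n i x)) \<le> \<epsilon>"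
    if "m \<ge> max K L" "n \<ge> max K L" for m n
  proof -
    have "mean_msq \<Phi> (\<lambda>i x. (Y m i x + Z m i x) - (Y n i x + Z n i x)) =
        mean_msq \<Phi> (\<lambda>i x. (Y m i x - Y n i x) + (Z m i x - Z n i x))"
      by (simp add: algebra_simps)
    also have "\<dots> \<le> 2 * mean_msq \<Phi> (\<lambda>i x. Y m i x - Y n i x) + 2 * mean_msq \<Phi> (\<lambda>i x. Z m i x - Z n i x)"
      by (intro mean_msq_add_le bfam_diff assms(1-3))
    also have "\<dots> \<le> \<epsilon>"
      using K[of m n] L[of m n] that by simp
    finally show ?thesis .
  qed
  then show "\<exists>N\<^sub>0. \<forall>m\<ge>N\<^sub>0. \<forall>n\<ge>N\<^sub>0. mean_msq \<Phi> (\<lambda>i x. Y m i x + Z m i x - (Y n i x + Z n i x)) \<le> \<epsilon>"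
    by blast
qed

lemma mean_cauchy_cmult:
  assumes "is_mean \<Phi>" "\<And>n. bfam (Y n)" "mean_cauchy \<Phi> Y"
  shows "mean_cauchy \<Phi> (\<lambda>n i x. c * Y n i x)"
  unfolding mean_cauchy_def
proof (intro allI impI)
  fix \<epsilon> :: real assume "\<epsilon> > 0"
  then have "\<epsilon> / ((cmod c)\<^sup>2 + 1) > 0" by (simp add: add_nonneg_pos)
  then obtain K where
    K: "mean_msq \<Phi> (\<lambda>i x. Y m i x - Y n i x) \<le> \<epsilon> / ((cmod c)\<^sup>2 + 1)" if "m \<ge> K" "n \<ge> K" for m n
    by (rule mean_cauchyD[OF assms(3)]) blast
  have "mean_msq \<Phi> (\<lambda>i x. c * Y m i x - c * Y n i x) \<le> \<epsilon>" if "m \<ge> K" "n \<ge> K" for m n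
  proof -
    have b: "bfam (\<lambda>i x. Y m i x - Y n i x)" by (intro bfam_diff assms(2))
    have "mean_msq \<Phi> (\<lambda>i x. c * Y m i x - c * Y n i x) = (cmod c)\<^sup>2 * mean_msq \<Phi> (\<lambda>i x. Y m i x - Y n i x)"
      using mean_msq_cmult[OF assms(1) b, of c] by (simp add: right_diff_distrib)
    also have "\<dots> \<le> ((cmod c)\<^sup>2 + 1) * mean_msq \<Phi> (\<lambda>i x. Y m i x - Y n i x)"
      using mean_msq_nonneg[OF assms(1) b] by (intro mult_right_mono) auto
    also have "\<dots> \<le> ((cmod c)\<^sup>2 + 1) * (\<epsilon> / ((cmod c)\<^sup>2 + 1))"
      by (intro mult_left_mono K that) simp
    also have "\<dots> = \<epsilon>"
      using \<open>\<epsilon> / ((cmod c)\<^sup>2 + 1) > 0\<close> by force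
    finally show ?thesis .
  qed
  then show "\<exists>N\<^sub>0. \<forall>m\<ge>N\<^sub>0. \<forall>n\<ge>N\<^sub>0. mean_msq \<Phi> (\<lambda>i x. c * Y m i x - c * Y n i x) \<le> \<epsilon>"
    by blast
qed

text \<open>
  A mean \<open>\<Psi>\<close> with a map \<open>\<rho>\<close> of indices extends \<open>\<Phi>\<close> if it agrees with \<open>\<Phi>\<close> on sequences pulled back along
  \<open>\<rho>\<close>. Pulling back is then isometric, so that it also preserves and reflects the Cauchy property.
\<close>

lemma mean_msq_extension:
  assumes "\<And>a. Bseq a \<Longrightarrow> \<Psi> (\<lambda>k. a (\<rho> k)) = \<Phi> a" "bfam F"
  shows "mean_msq \<Psi> (\<lambda>k. F (\<rho> k)) = mean_msq \<Phi> F"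
  unfolding mean_msq_def using assms(1)[OF Bseq_msq[OF assms(2)]] .

lemma mean_cauchy_extension:
  assumes "\<And>a. Bseq a \<Longrightarrow> \<Psi> (\<lambda>k. a (\<rho> k)) = \<Phi> a" "\<And>n. bfam (Y n)"
  shows "mean_cauchy \<Psi> (\<lambda>n k. Y n (\<rho> k)) \<longleftrightarrow> mean_cauchy \<Phi> Y"
  unfolding mean_cauchy_def
  using mean_msq_extension[of \<Psi> \<rho> \<Phi>, OF assms(1) bfam_diff[OF assms(2) assms(2)]] by simp

text \<open>
  The coefficient \<open>1 / C\<^sup>2\<close> minimises the quadratic bound \<open>\<parallel>u\<parallel>\<^sup>2 - 2 t a + t\<^sup>2 C\<^sup>2 a\<close> for the squared norm of
  \<open>u - t D\<close>, where \<open>a\<close> is the squared norm of \<open>A\<^sub>N u\<close>.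
\<close>

lemma msq_diff_dual_le:
  assumes "weights Q" "\<And>n i. g n i \<in> carrier G" "bfam u" "\<And>n i x. cmod (Q n i x) \<le> C" "C \<ge> 1"
  shows "msq (\<lambda>x. u i x - of_real (1 / C\<^sup>2) * dual g Q N u i x) \<le>
    msq (u i) - (1 / C\<^sup>2) * msq (wavg g Q N u i)"
proof -
  have D: "bfam (dual g Q N u)"
    by (rule bfam_dual_gen[where \<rho> = "\<lambda>a. a", OF assms(1-3)])
  have "(1 / C\<^sup>2)\<^sup>2 * msq (dual g Q N u i) \<le> (1 / C\<^sup>2)\<^sup>2 * (C\<^sup>2 * msq (wavg g Q N u i))"
    by (intro mult_left_mono msq_dual_le assms(1-4)) simp
  also have "\<dots> = (1 / C\<^sup>2) * msq (wavg g Q N u i)"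
    using assms(5) by (simp add: power2_eq_square)
  finally show ?thesis
    unfolding msq_diff_expand[OF assms(3) D] dual_inner[OF assms(1-3)] by simp
qed

text \<open>
  All dual functions as one family, over indices that code pairs \<open>(i, N)\<close>; the length of the average
  is \<open>N + 1\<close> as in \<open>window_mean\<close>.
\<close>

definition dual_family ::
    "(nat \<Rightarrow> nat \<Rightarrow> 'g) \<Rightarrow> (nat \<Rightarrow> nat \<Rightarrow> 'x \<Rightarrow> complex) \<Rightarrow> (nat \<Rightarrow> 'x \<Rightarrow> complex) \<Rightarrow> nat \<Rightarrow> 'x \<Rightarrow> complex"
  where "dual_family g Q u k = dual g Q (Suc (snd (prod_decode k))) u (fst (prod_decode k))"

definition dual_averages ::
    "(nat \<Rightarrow> nat \<Rightarrow> 'g) \<Rightarrow> (nat \<Rightarrow> nat \<Rightarrow> 'x \<Rightarrow> complex) \<Rightarrow> (nat \<Rightarrow> 'x \<Rightarrow> complex) \<Rightarrow> nat \<Rightarrow> nat \<Rightarrow> 'x \<Rightarrow> complex"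
  where "dual_averages g Q u n = wavg (\<lambda>n k. g n (fst (prod_decode k)))
    (\<lambda>n k. Q n (fst (prod_decode k))) n (dual_family g Q u)"

text \<open>
  The extremal argument. If the averages of the dual functions are Cauchy in every extension, then a
  nearly best approximation \<open>v\<close> of \<open>h\<close> leaves an error \<open>u\<close> with eventually small averages, since
  otherwise a multiple of the dual functions of \<open>u\<close> would improve on \<open>v\<close>.
\<close>

lemma wavg_cauchy_of_dual_averages:
  assumes Q: "weights Q" and g: "\<And>n i. g n i \<in> carrier G"
    and dual_cauchy: "\<And>\<Psi> \<rho> u S \<Lambda>. is_mean \<Psi> \<Longrightarrow> bfam u \<Longrightarrow> mean_along S \<Lambda> \<Longrightarrow>
      mean_cauchy (pair_mean \<Lambda> \<Psi>) (dual_averages (\<lambda>n i. g n (\<rho> i)) (\<lambda>n i. Q n (\<rho> i)) u)"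
    and \<Phi>: "is_mean \<Phi>" and h: "bfam h"
  shows "mean_cauchy \<Phi> (\<lambda>N. wavg g Q N h)"
proof -
  obtain C where C: "C \<ge> 1" "\<And>n i x. cmod (Q n i x) \<le> C"
    using bfam_bound[OF Q[unfolded weights_def]] by (metis fst_conv snd_conv)
  define ext where "ext \<Psi> \<rho> v \<longleftrightarrow> is_mean \<Psi> \<and> (\<forall>a. Bseq a \<longrightarrow> \<Psi> (\<lambda>k. a (\<rho> k)) = \<Phi> a) \<and> bfam v \<and>
      mean_cauchy \<Psi> (\<lambda>N. wavg (\<lambda>n i. g n (\<rho> i)) (\<lambda>n i. Q n (\<rho> i)) N v)"
    for \<Psi> :: "(nat \<Rightarrow> real) \<Rightarrow> real" and \<rho> :: "nat \<Rightarrow> nat" and v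
  define E where "E = {mean_msq \<Psi> (\<lambda>i x. h (\<rho> i) x - v i x) | \<Psi> \<rho> v. ext \<Psi> \<rho> v}"
  have E_mem: "mean_msq \<Psi> (\<lambda>i x. h (\<rho> i) x - v i x) \<in> E" if "ext \<Psi> \<rho> v" for \<Psi> \<rho> v
    using that unfolding E_def by blast
  \<comment> \<open>The infimum ranges over all extensions, so that passing to a further one cannot lower it.\<close>
  define d where "d = Inf E"
  have "ext \<Phi> (\<lambda>i. i) (\<lambda>_ _. 0)"
    using \<Phi>
    by (simp add: ext_def bfam_const mean_cauchy_def wavg_def cesaro_def mean_msq_def msq_def
        mean_const exI[of _ 0])
  then have "E \<noteq> {}" unfolding E_def by blast
  have "bdd_below E"
    unfolding E_def ext_def
    by (rule bdd_belowI[of _ 0]) (auto intro!: mean_msq_nonneg bfam_diff bfam_reindex[OF h])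
  have wR: "weights (\<lambda>n i. Q n (\<rho> i))" for \<rho> :: "nat \<Rightarrow> nat" by (rule weights_reindex[OF Q])
  show ?thesis
    unfolding mean_cauchy_def
  proof (intro allI impI)
    fix \<epsilon> :: real assume \<epsilon>: "\<epsilon> > 0"
    \<comment> \<open>The bound \<open>2 C\<^sup>2 \<delta>\<close> for the averages of \<open>u\<close> enters the final estimate with the factor 8.\<close>
    define \<delta> where "\<delta> = \<epsilon> / (32 * C\<^sup>2)"
    have \<delta>: "\<delta> > 0" and \<delta>C: "32 * (C\<^sup>2 * \<delta>) = \<epsilon>"
      using \<epsilon> C(1) by (auto simp: \<delta>_def)
    have "Inf E < d + \<delta>" using \<delta> by (simp add: d_def)
    then obtain e where e: "e \<in> E" "e < d + \<delta>"
      using cInf_lessD[OF \<open>E \<noteq> {}\<close>] by blast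
    from e(1) obtain \<Psi> \<rho> v where e_def: "e = mean_msq \<Psi> (\<lambda>i x. h (\<rho> i) x - v i x)"
      and "ext \<Psi> \<rho> v"
      unfolding E_def by blast
    let ?g = "\<lambda>n i. g n (\<rho> i)" and ?Q = "\<lambda>n i. Q n (\<rho> i)"
    from \<open>ext \<Psi> \<rho> v\<close> have \<Psi>: "is_mean \<Psi>" and \<Psi>\<Phi>: "\<And>a. Bseq a \<Longrightarrow> \<Psi> (\<lambda>k. a (\<rho> k)) = \<Phi> a"
      and v: "bfam v" and v_cauchy: "mean_cauchy \<Psi> (\<lambda>N. wavg ?g ?Q N v)"
      unfolding ext_def by blast+
    define u where "u = (\<lambda>i x. h (\<rho> i) x - v i x)"
    have u: "bfam u" unfolding u_def by (intro bfam_diff bfam_reindex[OF h] v)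
    let ?A = "\<lambda>N. wavg ?g ?Q N u"
    have A: "bfam (?A N)" for N by (intro bfam_wavg wR g u)
    have "finite {N. mean_msq \<Psi> (?A (Suc N)) > 2 * (C\<^sup>2 * \<delta>)}"
    proof (rule ccontr)
      let ?S = "{N. mean_msq \<Psi> (?A (Suc N)) > 2 * (C\<^sup>2 * \<delta>)}"
      \<comment> \<open>In the extension along \<open>?S\<close>, the element \<open>?w\<close> is nearer to \<open>h\<close> than \<open>d\<close> permits.\<close>
      assume "infinite ?S"
      then obtain \<Lambda> where \<Lambda>: "mean_along ?S \<Lambda>"
        using mean_along_exists by blast
      then have \<Lambda>_mean: "is_mean \<Lambda>" by (simp add: mean_along_def)
      let ?\<Theta> = "pair_mean \<Lambda> \<Psi>" and ?\<sigma> = "\<lambda>k. fst (prod_decode k)"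
      let ?D = "dual_family ?g ?Q u" and ?t = "1 / C\<^sup>2"
      let ?w = "\<lambda>k x. v (?\<sigma> k) x + of_real ?t * ?D k x"
      let ?G = "\<lambda>n k. g n (\<rho> (?\<sigma> k))" and ?P = "\<lambda>n k. Q n (\<rho> (?\<sigma> k))"
      have \<Theta>: "is_mean ?\<Theta>" by (rule is_mean_pair_mean[OF \<Lambda>_mean \<Psi>])
      have D: "bfam ?D"
        unfolding dual_family_def by (intro bfam_dual_gen wR g u)
      have w: "bfam ?w"
        by (intro bfam_add bfam_mult bfam_const bfam_reindex[OF v] D)
      have wP: "weights ?P" by (rule wR)
      have "mean_cauchy ?\<Theta> (\<lambda>N. wavg ?G ?P N (\<lambda>k. v (?\<sigma> k)))"
        using mean_cauchy_extension[of ?\<Theta> ?\<sigma> \<Psi> "\<lambda>N. wavg ?g ?Q N v"] v_cauchy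
          pair_mean_fst[OF \<Lambda>_mean] bfam_wavg[OF wR g v]
        by (simp add: wavg_reindex[of ?g ?\<sigma> ?Q, symmetric])
      moreover have "mean_cauchy ?\<Theta> (\<lambda>N k x. of_real ?t * wavg ?G ?P N ?D k x)"
        by (intro mean_cauchy_cmult \<Theta> bfam_wavg wP g D dual_cauchy[OF \<Psi> u \<Lambda>, unfolded dual_averages_def])
      ultimately have "mean_cauchy ?\<Theta> (\<lambda>N k x. wavg ?G ?P N (\<lambda>k. v (?\<sigma> k)) k x + of_real ?t * wavg ?G ?P N ?D k x)"
        by (intro mean_cauchy_add \<Theta> bfam_mult bfam_const bfam_wavg wP g D bfam_reindex[OF v])
      moreover have "(\<lambda>N. wavg ?G ?P N ?w) =
          (\<lambda>N k x. wavg ?G ?P N (\<lambda>k. v (?\<sigma> k)) k x + of_real ?t * wavg ?G ?P N ?D k x)"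
        by (intro ext) (simp only: wavg_add wavg_cmult)
      ultimately have "mean_cauchy ?\<Theta> (\<lambda>N. wavg ?G ?P N ?w)"
        by simp
      then have "ext ?\<Theta> (\<lambda>k. \<rho> (?\<sigma> k)) ?w"
        unfolding ext_def
        using \<Theta> w pair_mean_fst[OF \<Lambda>_mean, of \<Psi> "\<lambda>k. b (\<rho> k)" for b] \<Psi>\<Phi> by simp
      from E_mem[OF this] have "d \<le> mean_msq ?\<Theta> (\<lambda>k x. h (\<rho> (?\<sigma> k)) x - ?w k x)"
        unfolding d_def by (rule cInf_lower[OF _ \<open>bdd_below E\<close>])
      also have "\<dots> = mean_msq ?\<Theta> (\<lambda>k x. u (?\<sigma> k) x - of_real ?t * ?D k x)"
        by (simp add: u_def algebra_simps)
      also have "\<dots> = \<Lambda> (\<lambda>N. \<Psi> (\<lambda>i. msq (\<lambda>x. u i x - of_real ?t * dual ?g ?Q (Suc N) u i x)))"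
        by (simp add: mean_msq_def pair_mean_def dual_family_def)
      also have "\<dots> \<le> d - \<delta>"
      proof -
        have "bfam (\<lambda>k x. u (?\<sigma> k) x - of_real ?t * ?D k x)"
          by (intro bfam_diff bfam_mult bfam_const bfam_reindex[OF u] D)
        from Bseq_slice_mean[OF \<Psi> Bseq_msq[OF this]]
        have "Bseq (\<lambda>N. \<Psi> (\<lambda>i. msq (\<lambda>x. u i x - of_real ?t * dual ?g ?Q (Suc N) u i x)))"
          by (simp add: dual_family_def)
        moreover have "\<Psi> (\<lambda>i. msq (\<lambda>x. u i x - of_real ?t * dual ?g ?Q (Suc N) u i x)) \<le> d - \<delta>"
          if "N \<in> ?S" for N
        proof -
          have b: "bfam (\<lambda>i x. u i x - of_real ?t * dual ?g ?Q (Suc N) u i x)"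
            by (intro bfam_diff bfam_mult bfam_const u
                bfam_dual_gen[where \<rho> = "\<lambda>a. a" and N = "\<lambda>_. Suc N"] wR g)
          have "\<Psi> (\<lambda>i. msq (\<lambda>x. u i x - of_real ?t * dual ?g ?Q (Suc N) u i x)) \<le>
              \<Psi> (\<lambda>i. msq (u i) + (- ?t) * msq (?A (Suc N) i))"
          proof (rule mean_mono[OF \<Psi> Bseq_msq[OF b] Bseq_plus[OF Bseq_msq[OF u] Bseq_cmult[OF Bseq_msq[OF A]]]])
            fix i
            show "msq (\<lambda>x. u i x - of_real ?t * dual ?g ?Q (Suc N) u i x) \<le> msq (u i) + (- ?t) * msq (?A (Suc N) i)"
              using msq_diff_dual_le[where g = ?g and Q = ?Q and i = i and N = "Suc N", OF wR g u C(2) C(1)]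
              by simp
          qed
          also have "\<dots> = mean_msq \<Psi> u + (- ?t) * mean_msq \<Psi> (?A (Suc N))"
            unfolding mean_msq_def mean_add[OF \<Psi> Bseq_msq[OF u] Bseq_cmult[OF Bseq_msq[OF A]]]
              mean_cmult[OF \<Psi> Bseq_msq[OF A]] ..
          also have "\<dots> \<le> d - \<delta>"
          proof -
            have "?t * (2 * (C\<^sup>2 * \<delta>)) \<le> ?t * mean_msq \<Psi> (?A (Suc N))"
              using that by (intro mult_left_mono) auto
            moreover have "?t * (2 * (C\<^sup>2 * \<delta>)) = 2 * \<delta>"
              using C(1) by simp
            ultimately show ?thesis
              using e(2) unfolding e_def u_def[symmetric] by linarith
          qed
          finally show ?thesis .
        qed
        ultimately show ?thesis
          by (intro mean_alongD[OF \<Lambda>] always_eventually) blast+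
      qed
      finally show False using \<delta> by simp
    qed
    then obtain K\<^sub>1 where K\<^sub>1: "mean_msq \<Psi> (?A (Suc N)) \<le> 2 * (C\<^sup>2 * \<delta>)" if "N \<ge> K\<^sub>1" for N
      by (metis (no_types, lifting) finite_nat_set_iff_bounded linorder_not_less mem_Collect_eq)
    have \<epsilon>4: "\<epsilon> / 4 > 0" using \<epsilon> by simp
    obtain K\<^sub>2 where K\<^sub>2: "mean_msq \<Psi> (\<lambda>i x. wavg ?g ?Q m v i x - wavg ?g ?Q n v i x) \<le> \<epsilon> / 4"
      if "m \<ge> K\<^sub>2" "n \<ge> K\<^sub>2" for m n
      by (rule mean_cauchyD[OF v_cauchy \<epsilon>4]) blast
    have "mean_msq \<Phi> (\<lambda>i x. wavg g Q m h i x - wavg g Q n h i x) \<le> \<epsilon>"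
      if "m \<ge> max (Suc K\<^sub>1) K\<^sub>2" "n \<ge> max (Suc K\<^sub>1) K\<^sub>2" for m n
    proof -
      have hu: "h (\<rho> i) = (\<lambda>x. v i x + u i x)" for i by (simp add: u_def)
      have V: "bfam (wavg ?g ?Q N v)" for N by (intro bfam_wavg wR g v)
      have "mean_msq \<Phi> (\<lambda>i x. wavg g Q m h i x - wavg g Q n h i x) =
          mean_msq \<Psi> (\<lambda>i x. wavg g Q m h (\<rho> i) x - wavg g Q n h (\<rho> i) x)"
        using mean_msq_extension[of \<Psi> \<rho> \<Phi>, OF \<Psi>\<Phi> bfam_diff[OF bfam_wavg[OF Q g h] bfam_wavg[OF Q g h]]]
        by simp
      also have "\<dots> = mean_msq \<Psi> (\<lambda>i x. (wavg ?g ?Q m v i x - wavg ?g ?Q n v i x) + (?A m i x - ?A n i x))"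
        unfolding wavg_reindex[of g \<rho> Q, symmetric] hu wavg_add by (simp add: algebra_simps)
      also have "\<dots> \<le> 2 * mean_msq \<Psi> (\<lambda>i x. wavg ?g ?Q m v i x - wavg ?g ?Q n v i x)
          + 2 * mean_msq \<Psi> (\<lambda>i x. ?A m i x - ?A n i x)"
        by (intro mean_msq_add_le \<Psi> bfam_diff A V)
      also have "\<dots> \<le> 2 * mean_msq \<Psi> (\<lambda>i x. wavg ?g ?Q m v i x - wavg ?g ?Q n v i x)
          + 2 * (2 * mean_msq \<Psi> (?A m) + 2 * mean_msq \<Psi> (?A n))"
        using mean_msq_diff_le[OF \<Psi> A[of m] A[of n]] by simp
      also have "\<dots> \<le> 2 * (\<epsilon> / 4) + 2 * (2 * (2 * (C\<^sup>2 * \<delta>)) + 2 * (2 * (C\<^sup>2 * \<delta>)))"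
      proof -
        have "K\<^sub>1 \<le> m - 1" "Suc (m - 1) = m" "K\<^sub>1 \<le> n - 1" "Suc (n - 1) = n"
          using that by auto
        then have "mean_msq \<Psi> (?A m) \<le> 2 * (C\<^sup>2 * \<delta>)" "mean_msq \<Psi> (?A n) \<le> 2 * (C\<^sup>2 * \<delta>)"
          using K\<^sub>1[of "m - 1"] K\<^sub>1[of "n - 1"] by auto
        then show ?thesis
          using that by (intro add_mono mult_left_mono K\<^sub>2) auto
      qed
      also have "\<dots> = \<epsilon>" using \<delta>C by (simp add: mult.commute)
      finally show ?thesis .
    qed
    then show "\<exists>N\<^sub>0. \<forall>m\<ge>N\<^sub>0. \<forall>n\<ge>N\<^sub>0. mean_msq \<Phi> (\<lambda>i x. wavg g Q m h i x - wavg g Q n h i x) \<le> \<epsilon>"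
      by blast
  qed
qed


end

section \<open>Averages along a system and along its reduction\<close>

lemma bracket_closed:
  assumes "group \<Gamma>" "p \<in> carrier (seq_group \<Gamma>)" "q \<in> carrier (seq_group \<Gamma>)"
  shows "bracket \<Gamma> p q n \<in> carrier (seq_group \<Gamma>)"
proof -
  interpret group \<Gamma> by fact
  have "p m \<in> carrier \<Gamma>" "q m \<in> carrier \<Gamma>" for m
    using assms(2,3) by auto
  then show ?thesis
    by (simp add: PiE_iff bracket_apply[OF assms(1,2)])
qed

context pmp_action
begin

definition list_product ::
    "('i \<Rightarrow> 'h \<Rightarrow> 'g) \<Rightarrow> ((int \<Rightarrow> 'h) \<times> ('i \<Rightarrow> 'x \<Rightarrow> complex)) list \<Rightarrow> nat \<Rightarrow> 'i \<Rightarrow> 'x \<Rightarrow> complex"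
  where "list_product c L n i x = (\<Prod>(q, F)\<leftarrow>L. F i (T (c i (q (int n))) x))"

definition averages ::
    "('i \<Rightarrow> 'h \<Rightarrow> 'g) \<Rightarrow> ((int \<Rightarrow> 'h) \<times> ('i \<Rightarrow> 'x \<Rightarrow> complex)) list \<Rightarrow> nat \<Rightarrow> 'i \<Rightarrow> 'x \<Rightarrow> complex"
  where "averages c L N i x = cesaro N (\<lambda>n. list_product c L n i x)"

lemma list_product_Nil [simp]: "list_product c [] n i x = 1"
  and list_product_Cons [simp]:
    "list_product c ((q, F) # L) n i x = F i (T (c i (q (int n))) x) * list_product c L n i x"
  by (simp_all add: list_product_def)

lemma list_product_append [simp]:
  "list_product c (L @ L') n i x = list_product c L n i x * list_product c L' n i x"
  by (simp add: list_product_def)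

lemma weights_list_product:
  assumes "\<And>q F i n. (q, F) \<in> set L \<Longrightarrow> c i (q n) \<in> carrier G"
    and "\<And>q F. (q, F) \<in> set L \<Longrightarrow> bfam F"
  shows "weights (list_product c L)"
  unfolding weights_def using assms
proof (induction L)
  case Nil
  then show ?case by (simp add: list_product_def bfam_const)
next
  case (Cons b L)
  obtain q F where b: "b = (q, F)" by (cases b)
  have IH: "bfam (\<lambda>a. list_product c L (fst a) (snd a))"
  proof (rule Cons.IH)
    show "c i (q n) \<in> carrier G" if "(q, F) \<in> set L" for q F i n
      using Cons.prems(1)[of q F i n] that by simp
    show "bfam F" if "(q, F) \<in> set L" for q F
      using Cons.prems(2)[of q F] that by simp
  qed
  have g: "c i (q n) \<in> carrier G" for i n using Cons.prems(1)[of q F] b by simp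
  have "bfam F" using Cons.prems(2)[of q F] b by simp
  then have "bfam (\<lambda>a x. F (snd a) (T (c (snd a) (q (int (fst a)))) x))"
    by (intro bfam_T[OF bfam_reindex] g)
  moreover have "list_product c (b # L) n i = (\<lambda>x. F i (T (c i (q (int n))) x) * list_product c L n i x)"
    for n i
    by (simp add: b fun_eq_iff)
  ultimately show ?case
    using IH by (simp add: bfam_mult)
qed

text \<open>
  The inductive statement. It depends on the set of sequences only, because the functions are
  attached to sequences and a sequence may occur in \<open>L\<close> repeatedly or not at all; thus re-ordering
  and removal of duplicates are invisible to it.
\<close>

definition convergent_on :: "nat \<Rightarrow> (int \<Rightarrow> 'g tower) set \<Rightarrow> bool"
  where "convergent_on j S \<longleftrightarrow> (\<forall>c \<Phi> L.
    (\<forall>i. c i \<in> hom (tower_group G j) G) \<longrightarrow> is_mean \<Phi> \<longrightarrow>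
    (\<forall>(q, F) \<in> set L. q \<in> S \<and> bfam F) \<longrightarrow> mean_cauchy \<Phi> (averages c L))"

text \<open>
  The index \<open>t\<close> codes \<open>(k, m)\<close> with \<open>k\<close> coding \<open>(i, N)\<close>; a sequence \<open>q\<close> is evaluated at \<open>m\<close> and then mapped
  by \<open>c i\<close>. The value at \<open>Base\<close> is arbitrary, since the carrier consists of sequences.
\<close>

definition window_hom :: "(nat \<Rightarrow> 'g tower \<Rightarrow> 'g) \<Rightarrow> nat \<Rightarrow> 'g tower \<Rightarrow> 'g"
  where "window_hom c t s = (case s of Base _ \<Rightarrow> \<one>
    | Seq q \<Rightarrow> c (fst (prod_decode (fst (prod_decode t)))) (q (int (snd (prod_decode t)))))"

lemma window_hom_in_hom:
  assumes "\<And>i. c i \<in> hom (tower_group G j) G"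
  shows "window_hom c t \<in> hom (tower_group G (Suc j)) G"
proof (rule homI)
  let ?\<Gamma> = "tower_group G j"
  have carrier: "carrier (tower_group G (Suc j)) = Seq ` carrier (seq_group ?\<Gamma>)"
    by (simp add: image_group_carrier)
  fix s assume "s \<in> carrier (tower_group G (Suc j))"
  then obtain a where a: "a \<in> carrier (seq_group ?\<Gamma>)" "s = Seq a" unfolding carrier by blast
  then have "a m \<in> carrier ?\<Gamma>" for m by auto
  then show "window_hom c t s \<in> carrier G"
    by (simp add: window_hom_def a(2) hom_in_carrier[OF assms])
  fix s' assume "s' \<in> carrier (tower_group G (Suc j))"
  then obtain a' where a': "a' \<in> carrier (seq_group ?\<Gamma>)" "s' = Seq a'" unfolding carrier by blast
  have "Seq \<in> hom (seq_group ?\<Gamma>) (tower_group G (Suc j))"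
    using Seq_iso[OF is_group, of j] by (simp only: iso_def mem_Collect_eq)
  from hom_mult[OF this a(1) a'(1)]
  have eq: "Seq (a \<otimes>\<^bsub>seq_group ?\<Gamma>\<^esub> a') = Seq a \<otimes>\<^bsub>tower_group G (Suc j)\<^esub> Seq a'" .
  have "s \<otimes>\<^bsub>tower_group G (Suc j)\<^esub> s' = Seq (\<lambda>m. a m \<otimes>\<^bsub>?\<Gamma>\<^esub> a' m)"
    unfolding a(2) a'(2) eq[symmetric] by (simp add: fun_eq_iff)
  moreover have "a m \<in> carrier ?\<Gamma>" "a' m \<in> carrier ?\<Gamma>" for m
    using a(1) a'(1) by auto
  ultimately show "window_hom c t (s \<otimes>\<^bsub>tower_group G (Suc j)\<^esub> s') = window_hom c t s \<otimes> window_hom c t s'"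
    using hom_mult[OF assms] by (simp add: window_hom_def a(2) a'(2))
qed

text \<open>
  Up to an error that vanishes as \<open>N \<rightarrow> \<infinity>\<close>, the \<open>n\<close>-th average of the dual functions at the index
  \<open>(i, N)\<close> is the mean over \<open>m \<le> N + 1\<close> of the \<open>n\<close>-th average, at the index \<open>(i, N, m)\<close>, of the reduced
  system with suitable functions. The latter averages are Cauchy for the window mean, and by the
  Cauchy-Schwarz inequality this survives taking the mean over \<open>m\<close>.
\<close>

lemma dual_averages_cauchy:
  assumes c: "\<And>i. c i \<in> hom (tower_group G j) G"
    and p: "p \<in> carrier (seq_group (tower_group G j))"
    and R: "\<And>q F. (q, F) \<in> set R \<Longrightarrow> q \<in> carrier (seq_group (tower_group G j))"
      "\<And>q F. (q, F) \<in> set R \<Longrightarrow> bfam F"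
    and conv: "convergent_on (Suc j) S"
    and S: "\<And>q F. (q, F) \<in> set R \<Longrightarrow> Seq \<circ> (\<iota> \<circ> q) \<in> S"
      "\<And>q F. (q, F) \<in> set R \<Longrightarrow> Seq \<circ> bracket (tower_group G j) p q \<in> S"
      "Seq \<circ> bracket (tower_group G j) p \<one>\<^bsub>seq_group (tower_group G j)\<^esub> \<in> S"
    and \<Phi>: "is_mean \<Phi>" and u: "bfam u" and \<Lambda>: "mean_along A \<Lambda>"
  shows "mean_cauchy (pair_mean \<Lambda> \<Phi>) (dual_averages (\<lambda>n i. c i (p (int n))) (list_product c R) u)"
proof -
  let ?\<Gamma> = "tower_group G j"
  interpret \<Gamma>: group ?\<Gamma> by (rule tower_group_group[OF is_group])
  have ghom: "group_hom ?\<Gamma> G (c i)" for i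
    by (simp add: group_hom_def group_hom_axioms_def is_group \<Gamma>.is_group c)
  have pc: "p n \<in> carrier ?\<Gamma>" for n using p by auto
  define g where "g n i = c i (p (int n))" for n i
  define Q where "Q = list_product c R"
  have g: "g n i \<in> carrier G" for n i
    unfolding g_def by (rule hom_in_carrier[OF c pc])
  have Q: "weights Q"
    unfolding Q_def using R
    by (intro weights_list_product hom_in_carrier[OF c]) auto
  have \<Lambda>_mean: "is_mean \<Lambda>" using \<Lambda> by (simp add: mean_along_def)
  define \<Psi> where "\<Psi> = pair_mean \<Lambda> \<Phi>"
  have \<Psi>: "is_mean \<Psi>" unfolding \<Psi>_def by (rule is_mean_pair_mean[OF \<Lambda>_mean \<Phi>])

  define idx where "idx k = fst (prod_decode k)" for k :: nat
  define len where "len k = Suc (snd (prod_decode k))" for k :: nat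
  define a where "a k = wavg g Q (len k) u (idx k)" for k
  have a: "bfam a" unfolding a_def by (rule bfam_wavg_gen[OF Q g u])
  define w where "w k l m x = a k (T (inv g m (idx k) \<otimes> g l (idx k)) x)
      * cnj (Q m (idx k) (T (inv g m (idx k) \<otimes> g l (idx k)) x))" for k l m x
  have dual_shift: "dual_family g Q u k (T (g l (idx k)) x) = cesaro (len k) (\<lambda>m. w k l m x)" for k l x
    unfolding dual_family_def dual_def idx_def[symmetric] len_def[symmetric] w_def a_def
    by (simp add: T_mult g)

  \<comment> \<open>The functions that make the average of the reduced system at \<open>(i, N, m)\<close> equal to the
    average of \<open>Q l \<cdot> w l (l + m)\<close> over \<open>l\<close>: the entry for \<open>e\<close> carries \<open>A\<^sub>N u\<close>.\<close>
  define base where "base t = fst (prod_decode t)" for t :: nat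
  have base_enc: "base (prod_encode (k, m)) = k" for k m by (simp add: base_def)
  define L where "L = map (\<lambda>(q, F). (Seq \<circ> (\<iota> \<circ> q), \<lambda>t. F (idx (base t)))) R
      @ (Seq \<circ> bracket ?\<Gamma> p \<one>\<^bsub>seq_group ?\<Gamma>\<^esub>, \<lambda>t. a (base t))
      # map (\<lambda>(q, F). (Seq \<circ> bracket ?\<Gamma> p q, \<lambda>t x. cnj (F (idx (base t)) x))) R"
  have L: "\<forall>(q, F) \<in> set L. q \<in> S \<and> bfam F"
  proof -
    have "bfam (\<lambda>t. F (idx (base t)))" if "(q, F) \<in> set R" for q F
      by (rule bfam_reindex[OF R(2)[OF that]])
    then show ?thesis
      using S by (auto simp: L_def intro!: bfam_reindex[OF a] bfam_cnj)
  qed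
  let ?c = "window_hom c"
  have "\<forall>t. ?c t \<in> hom (tower_group G (Suc j)) G" by (intro allI window_hom_in_hom c)
  with conv L have conv': "mean_cauchy \<Phi>' (averages ?c L)" if "is_mean \<Phi>'" for \<Phi>'
    using that unfolding convergent_on_def by blast

  have bracket_hom: "T (?c (prod_encode (k, m)) (Seq (bracket ?\<Gamma> p q (int l)))) x =
      T (c (idx k) (q (int (l + m)))) (T (inv g (l + m) (idx k) \<otimes> g l (idx k)) x)"
    if "q \<in> carrier (seq_group ?\<Gamma>)" for k m q l x
  proof -
    have qc: "q n \<in> carrier ?\<Gamma>" for n using that by auto
    have "?c (prod_encode (k, m)) (Seq (bracket ?\<Gamma> p q (int l))) =
        c (idx k) (q (int (l + m)) \<otimes>\<^bsub>?\<Gamma>\<^esub> inv\<^bsub>?\<Gamma>\<^esub> p (int (l + m)) \<otimes>\<^bsub>?\<Gamma>\<^esub> p (int l))"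
      by (simp add: window_hom_def idx_def bracket_apply[OF \<Gamma>.is_group p])
    also have "\<dots> = c (idx k) (q (int (l + m))) \<otimes> (inv g (l + m) (idx k) \<otimes> g l (idx k))"
      using qc pc hom_in_carrier[OF c qc] g
      by (simp add: hom_mult[OF c] group_hom.hom_inv[OF ghom] g_def[symmetric] m_assoc
          del: of_nat_add)
    finally show ?thesis
      using hom_in_carrier[OF c qc] g by (simp add: T_mult)
  qed
  have one_hom: "c i (\<one>\<^bsub>seq_group ?\<Gamma>\<^esub> n) = \<one>" for i n
    by (simp add: group_hom.hom_one[OF ghom])
  have first: "list_product ?c (map (\<lambda>(q, F). (Seq \<circ> (\<iota> \<circ> q), \<lambda>t. F (idx (base t)))) R') l
      (prod_encode (k, m)) x = list_product c R' l (idx k) x" for R' l k m x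
    by (induction R') (auto simp: window_hom_def base_def idx_def const_seq_def)
  have last: "list_product ?c
      (map (\<lambda>(q, F). (Seq \<circ> bracket ?\<Gamma> p q, \<lambda>t x. cnj (F (idx (base t)) x))) R') l
      (prod_encode (k, m)) x = cnj (list_product c R' (l + m) (idx k) (T (inv g (l + m) (idx k) \<otimes> g l (idx k)) x))"
    if "set R' \<subseteq> set R" for R' l k m x
    using that
  proof (induction R')
    case (Cons b R')
    obtain q F where b: "b = (q, F)" by (cases b)
    then have "q \<in> carrier (seq_group ?\<Gamma>)" using Cons.prems R(1) by auto
    then show ?case
      using Cons by (simp add: b bracket_hom base_def del: carrier_product_group of_nat_add)
  qed simp
  have one_c: "\<one>\<^bsub>seq_group ?\<Gamma>\<^esub> \<in> carrier (seq_group ?\<Gamma>)"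
    by simp
  have product: "list_product ?c L l (prod_encode (k, m)) x = Q l (idx k) x * w k l (l + m) x" for l k m x
    by (simp add: L_def first last[OF order_refl] bracket_hom[OF one_c] one_hom T_one Q_def w_def
        base_enc del: one_product_group of_nat_add)

  \<comment> \<open>The main term; it differs from \<open>?d\<close> by the shift of the summation over \<open>m\<close>.\<close>
  define av where "av n k x = cesaro (len k) (\<lambda>m. averages ?c L n (prod_encode (k, m)) x)" for n k x
  let ?d = "dual_averages g Q u"
  obtain C where C: "C \<ge> 1" "\<And>n i x. cmod (Q n i x) \<le> C"
    using bfam_bound[OF Q[unfolded weights_def]] by (metis fst_conv snd_conv)
  obtain B where B: "B \<ge> 1" "\<And>k x. cmod (a k x) \<le> B"
    using bfam_bound[OF a] by metis
  have w_bound: "cmod (w k l m x) \<le> B * C" for k l m x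
    using B C order_trans[OF zero_le_one B(1)] by (auto simp: w_def norm_mult intro!: mult_mono)
  have d_eq: "?d n k x = cesaro n (\<lambda>l. Q l (idx k) x * cesaro (len k) (\<lambda>m. w k l m x))" for n k x
    by (simp add: dual_averages_def wavg_def idx_def[symmetric] dual_shift)
  have av_eq: "av n k x = cesaro n (\<lambda>l. Q l (idx k) x * cesaro (len k) (\<lambda>m. w k l (l + m) x))" for n k x
    unfolding av_def averages_def product
    by (subst cesaro_swap) (simp add: cesaro_mult_left)
  have error: "cmod (?d n k x - av n k x) \<le> C * (2 * real n * (B * C)) / real (len k)" for n k x
  proof -
    have "?d n k x - av n k x = cesaro n (\<lambda>l. Q l (idx k) x *
        (cesaro (len k) (\<lambda>m. w k l m x) - cesaro (len k) (\<lambda>m. w k l (l + m) x)))"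
      by (simp only: d_eq av_eq right_diff_distrib cesaro_diff)
    also have "cmod \<dots> \<le> C * (2 * real n * (B * C) / real (len k))"
    proof (rule cesaro_bound)
      fix l assume "l \<le> n"
      have "cmod (cesaro (len k) (\<lambda>m. w k l m x) - cesaro (len k) (\<lambda>m. w k l (l + m) x))
          \<le> 2 * real l * (B * C) / real (len k)"
        by (rule cesaro_shift[OF w_bound])
      also have "\<dots> \<le> 2 * real n * (B * C) / real (len k)"
        using \<open>l \<le> n\<close> B(1) C(1) by (intro divide_right_mono mult_right_mono) auto
      finally show "cmod (Q l (idx k) x * (cesaro (len k) (\<lambda>m. w k l m x) - cesaro (len k) (\<lambda>m. w k l (l + m) x)))
          \<le> C * (2 * real n * (B * C) / real (len k))"
        unfolding norm_mult using C by (intro mult_mono) auto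
    qed
    finally show ?thesis by simp
  qed

  have d: "bfam (?d n)" for n
    unfolding dual_averages_def dual_family_def
    by (intro bfam_wavg weights_reindex[OF Q] g bfam_dual_gen[OF Q g u])
  have tower_mem: "?c t (q n) \<in> carrier G" if "(q, F) \<in> set L" for t q F n
  proof -
    have "bracket ?\<Gamma> p q n m \<in> carrier ?\<Gamma>" if "q \<in> carrier (seq_group ?\<Gamma>)" for q n m
      using bracket_closed[OF \<Gamma>.is_group p that, of n] by auto
    moreover have "q n \<in> carrier ?\<Gamma>" if "(q, F) \<in> set R" for q F n
      using R(1)[OF that] by auto
    ultimately show ?thesis
      using \<open>(q, F) \<in> set L\<close> R(1) hom_in_carrier[OF c] one_c
      by (auto simp: L_def window_hom_def const_seq_def simp del: one_product_group)
  qed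
  have "weights (list_product ?c L)"
    using L by (intro weights_list_product tower_mem) auto
  from bfam_cesaro[OF weights_bfam[OF this, of fst snd]]
  have averages: "bfam (averages ?c L n)" for n
    unfolding averages_def .
  have av: "bfam (av n)" for n
    unfolding av_def by (intro bfam_cesaro bfam_reindex[OF averages])

  show ?thesis
    unfolding mean_cauchy_def g_def[symmetric] Q_def[symmetric] \<Psi>_def[symmetric]
  proof (intro allI impI)
    fix \<epsilon> :: real assume \<epsilon>: "\<epsilon> > 0"
    then have "\<epsilon> / 4 > 0" by simp
    then obtain K where
      K: "mean_msq (window_mean \<Psi>) (\<lambda>t x. averages ?c L m t x - averages ?c L n t x) \<le> \<epsilon> / 4"
      if "m \<ge> K" "n \<ge> K" for m n
      by (rule mean_cauchyD[OF conv'[OF is_mean_window_mean[OF \<Psi>]]]) blast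
    have "mean_msq \<Psi> (\<lambda>k x. ?d m k x - ?d n k x) \<le> \<epsilon>" if mn: "m \<ge> K" "n \<ge> K" for m n
    proof -
      let ?e = "\<lambda>k x. (?d m k x - av m k x) - (?d n k x - av n k x)"
      have e: "bfam ?e" by (intro bfam_diff d av)
      have av_diff: "bfam (\<lambda>t x. averages ?c L m t x - averages ?c L n t x)"
        by (intro bfam_diff averages)
      have "mean_msq \<Psi> (\<lambda>k x. av m k x - av n k x) \<le>
          mean_msq (window_mean \<Psi>) (\<lambda>t x. averages ?c L m t x - averages ?c L n t x)"
        unfolding mean_msq_def window_mean_def
      proof (rule mean_mono[OF \<Psi> Bseq_msq[OF bfam_diff[OF av av]] Bseq_window[OF Bseq_msq[OF av_diff]]])
        fix k
        show "msq (\<lambda>x. av m k x - av n k x) \<le> (let N = Suc (snd (prod_decode k)) in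
          (\<Sum>r = 1..N. msq (\<lambda>x. averages ?c L m (prod_encode (k, r)) x - averages ?c L n (prod_encode (k, r)) x)) / real N)"
          unfolding av_def cesaro_diff[symmetric] Let_def len_def[symmetric]
          by (rule msq_cesaro_le[OF bfam_reindex[OF av_diff]])
      qed
      also have "\<dots> \<le> \<epsilon> / 4" by (rule K[OF mn])
      finally have main: "mean_msq \<Psi> (\<lambda>k x. av m k x - av n k x) \<le> \<epsilon> / 4" .
      define Z where "Z = C * (2 * real m * (B * C)) + C * (2 * real n * (B * C))"
      have e_bound: "cmod (?e k x) \<le> Z / real (len k)" for k x
      proof -
        have "cmod (?e k x) \<le> cmod (?d m k x - av m k x) + cmod (?d n k x - av n k x)"
          by (rule norm_triangle_ineq4)
        also have "\<dots> \<le> C * (2 * real m * (B * C)) / real (len k) + C * (2 * real n * (B * C)) / real (len k)"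
          by (intro add_mono error)
        finally show ?thesis by (simp add: Z_def add_divide_distrib)
      qed
      have "(\<lambda>N. (Z / real (Suc N))\<^sup>2) \<longlonglongrightarrow> 0\<^sup>2"
        by (intro tendsto_power) (rule LIMSEQ_Suc[OF lim_const_over_n])
      then have small: "\<forall>\<^sub>F N in sequentially. (Z / real (Suc N))\<^sup>2 < \<epsilon> / 4"
        by (rule order_tendstoD(2)) (simp add: \<epsilon>)
      have slice: "\<Phi> (\<lambda>i. msq (?e (prod_encode (i, N)))) \<le> (Z / real (Suc N))\<^sup>2" for N
      proof -
        have "\<bar>\<Phi> (\<lambda>i. msq (?e (prod_encode (i, N))))\<bar> \<le> (Z / real (Suc N))\<^sup>2"
        proof (rule mean_abs_le[OF \<Phi>])
          fix i
          have "msq (?e (prod_encode (i, N))) \<le> (Z / real (Suc N))\<^sup>2"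
            using e_bound[of "prod_encode (i, N)"]
            by (intro msq_bound bfam_measurable[OF e]) (simp add: len_def)
          then show "\<bar>msq (?e (prod_encode (i, N)))\<bar> \<le> (Z / real (Suc N))\<^sup>2"
            using msq_nonneg[of "?e (prod_encode (i, N))"] by simp
        qed
        then show ?thesis by simp
      qed
      have "\<forall>\<^sub>F N in sequentially. N \<in> A \<longrightarrow> \<Phi> (\<lambda>i. msq (?e (prod_encode (i, N)))) \<le> \<epsilon> / 4"
        using small by (rule eventually_mono) (intro impI order_trans[OF slice less_imp_le])
      then have "mean_msq \<Psi> ?e \<le> \<epsilon> / 4"
        unfolding mean_msq_def \<Psi>_def pair_mean_def
        by (rule mean_alongD[OF \<Lambda> Bseq_slice_mean[OF \<Phi> Bseq_msq[OF e]]])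
      moreover have "mean_msq \<Psi> (\<lambda>k x. (av m k x - av n k x) + ?e k x) \<le>
          2 * mean_msq \<Psi> (\<lambda>k x. av m k x - av n k x) + 2 * mean_msq \<Psi> ?e"
        by (intro mean_msq_add_le \<Psi> bfam_diff[OF av av] e)
      moreover have "(av m k x - av n k x) + ?e k x = ?d m k x - ?d n k x" for k x
        by simp
      ultimately show ?thesis using main by simp
    qed
    then show "\<exists>N\<^sub>0. \<forall>m\<ge>N\<^sub>0. \<forall>n\<ge>N\<^sub>0. mean_msq \<Psi> (\<lambda>k x. ?d m k x - ?d n k x) \<le> \<epsilon>"
      by blast
  qed
qed


section \<open>Systems of finite complexity\<close>

lemma list_product_split:
  "list_product c L n i x =
    list_product c (filter (\<lambda>(q, F). q \<noteq> p) L) n i x *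
    (\<Prod>(q, F)\<leftarrow>filter (\<lambda>(q, F). q = p) L. F i (T (c i (p (int n))) x))"
  by (induction L) auto

text \<open>
  The functions at the last entry \<open>p\<close> of the system are multiplied to one function \<open>h\<close>, and all others
  form the weights. An entry equal to \<open>p\<close> may also occur earlier in the system; its functions go
  into \<open>h\<close> as well, hence the weights involve entries of \<open>butlast ps\<close> only.
\<close>

lemma convergent_on_reduction:
  assumes ps: "is_system (tower_group G j) ps" "ps \<noteq> []"
    and conv: "convergent_on (Suc j) (set (map (\<lambda>p. Seq \<circ> p) (reduction (tower_group G j) ps)))"
  shows "convergent_on j (set ps)"
  unfolding convergent_on_def
proof (intro allI impI)
  let ?\<Gamma> = "tower_group G j"
  fix c :: "nat \<Rightarrow> 'g tower \<Rightarrow> 'g" and \<Phi> and L :: "((int \<Rightarrow> 'g tower) \<times> (nat \<Rightarrow> 'x \<Rightarrow> complex)) list"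
  assume c: "\<forall>i. c i \<in> hom ?\<Gamma> G" and \<Phi>: "is_mean \<Phi>"
    and L: "\<forall>(q, F) \<in> set L. q \<in> set ps \<and> bfam F"
  have c': "c i \<in> hom ?\<Gamma> G" for i using c by blast
  define p where "p = last ps"
  define R where "R = filter (\<lambda>(q, F). q \<noteq> p) L"
  define h where "h i x = (\<Prod>(q, F)\<leftarrow>filter (\<lambda>(q, F). q = p) L. F i x)" for i x
  have p: "p \<in> carrier (seq_group ?\<Gamma>)"
    using ps unfolding p_def is_system_def by simp
  have set_ps: "set ps = insert p (set (butlast ps))"
    using ps(2) unfolding p_def by (metis append_butlast_last_id list.simps(15) rotate1.simps(2) set_rotate1)
  have R: "q \<in> carrier (seq_group ?\<Gamma>)" "bfam F" "q \<in> set (butlast ps)" if "(q, F) \<in> set R" for q F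
    using that L ps(1) set_ps unfolding R_def is_system_def by auto
  have h: "bfam h"
    unfolding h_def using L by (intro bfam_prod_list) auto
  have h': "list_product c L n i x = list_product c R n i x * h i (T (c i (p (int n))) x)" for n i x
    unfolding R_def h_def by (rule list_product_split)
  let ?g = "\<lambda>n i. c i (p (int n))"
  have "p n \<in> carrier ?\<Gamma>" for n using p by auto
  then have g: "?g n i \<in> carrier G" for n i by (rule hom_in_carrier[OF c'])
  have Rc: "q n \<in> carrier ?\<Gamma>" if "(q, F) \<in> set R" for q F n
    using R(1)[OF that] by auto
  have "mean_cauchy \<Phi> (\<lambda>N. wavg ?g (list_product c R) N h)"
  proof (rule wavg_cauchy_of_dual_averages[OF _ g _ \<Phi> h])
    show "weights (list_product c R)"
      by (intro weights_list_product) (auto intro: R(2) hom_in_carrier[OF c' Rc])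
  next
    fix \<Psi> :: "(nat \<Rightarrow> real) \<Rightarrow> real" and \<rho> :: "nat \<Rightarrow> nat" and u :: "nat \<Rightarrow> 'x \<Rightarrow> complex"
      and S :: "nat set" and \<Lambda> :: "(nat \<Rightarrow> real) \<Rightarrow> real"
    assume \<Psi>: "is_mean \<Psi>" and u: "bfam u" and \<Lambda>: "mean_along S \<Lambda>"
    let ?R = "map (\<lambda>(q, F). (q, \<lambda>i. F (\<rho> i))) R"
    have "list_product (\<lambda>i. c (\<rho> i)) (map (\<lambda>(q, F). (q, \<lambda>i. F (\<rho> i))) R') n i x =
        list_product c R' n (\<rho> i) x" for n i x R'
      by (induction R') auto
    then have eq: "list_product (\<lambda>i. c (\<rho> i)) ?R = (\<lambda>n i. list_product c R n (\<rho> i))"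
      by (intro ext)
    have "mean_cauchy (pair_mean \<Lambda> \<Psi>)
        (dual_averages (\<lambda>n i. c (\<rho> i) (p (int n))) (list_product (\<lambda>i. c (\<rho> i)) ?R) u)"
    proof (rule dual_averages_cauchy[OF c' p _ _ conv _ _ _ \<Psi> u \<Lambda>])
      fix q F assume "(q, F) \<in> set ?R"
      then obtain F' where F': "(q, F') \<in> set R" "F = (\<lambda>i. F' (\<rho> i))" by auto
      show "q \<in> carrier (seq_group ?\<Gamma>)" by (rule R(1)[OF F'(1)])
      show "bfam F" unfolding F'(2) by (rule bfam_reindex[OF R(2)[OF F'(1)]])
      show "Seq \<circ> (\<iota> \<circ> q) \<in> set (map (\<lambda>p. Seq \<circ> p) (reduction ?\<Gamma> ps))"
        "Seq \<circ> bracket ?\<Gamma> p q \<in> set (map (\<lambda>p. Seq \<circ> p) (reduction ?\<Gamma> ps))"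
        using R(3)[OF F'(1)] unfolding reduction_def p_def by auto
    next
      show "Seq \<circ> bracket ?\<Gamma> p \<one>\<^bsub>seq_group ?\<Gamma>\<^esub> \<in> set (map (\<lambda>p. Seq \<circ> p) (reduction ?\<Gamma> ps))"
        unfolding reduction_def p_def by simp
    qed
    then show "mean_cauchy (pair_mean \<Lambda> \<Psi>)
        (dual_averages (\<lambda>n i. c (\<rho> i) (p (int n))) (\<lambda>n i. list_product c R n (\<rho> i)) u)"
      unfolding eq .
  qed
  moreover have "averages c L = (\<lambda>N. wavg ?g (list_product c R) N h)"
    by (simp add: fun_eq_iff averages_def wavg_def h')
  ultimately show "mean_cauchy \<Phi> (averages c L)" by simp
qed

lemma is_system_reduction:
  assumes "is_system (tower_group G j) ps" "ps \<noteq> []"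
  shows "is_system (tower_group G (Suc j)) (map (\<lambda>p. Seq \<circ> p) (reduction (tower_group G j) ps))"
proof -
  let ?\<Gamma> = "tower_group G j"
  interpret \<Gamma>: group ?\<Gamma> by (rule tower_group_group[OF is_group])
  have carrier: "carrier (tower_group G (Suc j)) = Seq ` carrier (seq_group ?\<Gamma>)"
    by (simp add: image_group_carrier)
  have "r n \<in> carrier (seq_group ?\<Gamma>)" if "r \<in> set (reduction ?\<Gamma> ps)" for r n
  proof -
    have ps: "q \<in> carrier (seq_group ?\<Gamma>)" if "q \<in> set ps" for q
      using assms(1) that unfolding is_system_def by blast
    then have pn: "q m \<in> carrier ?\<Gamma>" if "q \<in> set ps" for q m
      using ps[OF that] by auto
    have "r \<in> (\<lambda>p. \<iota> \<circ> p) ` set (butlast ps) \<union>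
        bracket ?\<Gamma> (last ps) ` insert \<one>\<^bsub>seq_group ?\<Gamma>\<^esub> (set (butlast ps))"
      using that unfolding reduction_def by (simp only: set_append set_map list.simps(15))
    then consider q where "q \<in> set (butlast ps)" "r = \<iota> \<circ> q"
      | q where "q \<in> insert \<one>\<^bsub>seq_group ?\<Gamma>\<^esub> (set (butlast ps))" "r = bracket ?\<Gamma> (last ps) q"
      by blast
    then show ?thesis
    proof cases
      case 1
      then show ?thesis using pn[OF in_set_butlastD] by (simp add: const_seq_def PiE_iff)
    next
      case 2
      have "\<one>\<^bsub>seq_group ?\<Gamma>\<^esub> \<in> carrier (seq_group ?\<Gamma>)" by simp
      then have "q \<in> carrier (seq_group ?\<Gamma>)"
        using 2(1) ps[OF in_set_butlastD] by blast
      then show ?thesis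
        unfolding 2(2) by (rule bracket_closed[OF \<Gamma>.is_group ps[OF last_in_set[OF assms(2)]]])
    qed
  qed
  then show ?thesis
    unfolding is_system_def
    by (auto simp: PiE_iff carrier simp del: tower_group.simps)
qed

lemma convergent_on_trivial:
  assumes "trivial_system ps"
  shows "convergent_on j (set ps)"
  unfolding convergent_on_def
proof (intro allI impI)
  fix c :: "nat \<Rightarrow> 'g tower \<Rightarrow> 'g" and \<Phi> and L :: "((int \<Rightarrow> 'g tower) \<times> (nat \<Rightarrow> 'x \<Rightarrow> complex)) list"
  assume \<Phi>: "is_mean \<Phi>" and L: "\<forall>(q, F) \<in> set L. q \<in> set ps \<and> bfam F"
  have const: "fst a n = fst a 0" if "a \<in> set L" for a n
  proof -
    have "fst a \<in> set ps"
      using bspec[OF L that] by (simp add: case_prod_unfold)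
    then have "fst a constant_on UNIV"
      using assms unfolding trivial_system_def by blast
    then obtain y where "\<And>m. fst a m = y" unfolding constant_on_def by blast
    then show ?thesis by simp
  qed
  have stationary: "list_product c L n i x = list_product c L 0 i x" for n i x
    unfolding list_product_def
    by (intro arg_cong[of _ _ prod_list] map_cong refl)
      (simp add: case_prod_unfold const[of _ "int n"])
  have "averages c L N i x = list_product c L 0 i x" if "N \<ge> 1" for N i x
    unfolding averages_def
    by (rule trans[OF cesaro_cong[OF stationary] cesaro_const[OF that]])
  then have "mean_msq \<Phi> (\<lambda>i x. averages c L m i x - averages c L n i x) = 0" if "m \<ge> 1" "n \<ge> 1" for m n
    using that by (simp add: mean_msq_def msq_def mean_const[OF \<Phi>])
  then show "mean_cauchy \<Phi> (averages c L)"
    unfolding mean_cauchy_def by (intro allI impI exI[of _ 1]) simp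
qed

text \<open>Backwards along the sequence of operations, from the trivial system at its end.\<close>

lemma convergent_on_finite_complexity:
  assumes "(system_step G)\<^sup>*\<^sup>* (j, ps) (l, qs)" "trivial_system qs" "is_system (tower_group G j) ps"
  shows "convergent_on j (set ps)"
  using assms(1,3)
proof (induction "(j, ps)" arbitrary: j ps rule: converse_rtranclp_induct)
  case base
  then show ?case using convergent_on_trivial[OF assms(2)] by simp
next
  case (step z)
  from step.hyps(1) show ?case
  proof (cases rule: system_step.cases)
    case reduce
    then show ?thesis
      using step.prems step.hyps(3) is_system_reduction convergent_on_reduction by blast
  next
    case (reorder qs)
    then have "set qs = set ps" by (metis set_mset_mset)
    then show ?thesis
      using step.hyps(3)[OF reorder(1)] step.prems unfolding is_system_def by simp
  next
    case (dedup p qs rs)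
    then have "set (qs @ rs) = set ps" by auto
    then show ?thesis
      using step.hyps(3)[OF dedup(2)] step.prems unfolding is_system_def by metis
  qed
qed

section \<open>Convergence in the mean square\<close>

text \<open>
  By the elementary inequality \<open>a \<le> e/4 + a\<^sup>2/e\<close>, a sequence that is Cauchy in the mean square is
  Cauchy in the mean, so it has a subsequence that converges almost everywhere; bounded convergence
  then identifies the limit.
\<close>

lemma L2_complete_bounded:
  fixes Y :: "nat \<Rightarrow> 'x \<Rightarrow> complex"
  assumes Y: "bfam Y"
    and cauchy: "\<And>\<epsilon>. \<epsilon> > 0 \<Longrightarrow> \<exists>N\<^sub>0. \<forall>m \<ge> N\<^sub>0. \<forall>n \<ge> N\<^sub>0. msq (\<lambda>x. Y m x - Y n x) \<le> \<epsilon>"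
  obtains F where "F \<in> borel_measurable M" "integrable M (\<lambda>x. (cmod (F x))\<^sup>2)"
    "(\<lambda>n. msq (\<lambda>x. Y n x - F x)) \<longlonglongrightarrow> 0"
proof -
  obtain C where C: "C \<ge> 1" "\<And>n x. cmod (Y n x) \<le> C" using bfam_bound[OF Y] by metis
  note [measurable] = bfam_measurable[OF Y]
  have L1: "\<exists>N. \<forall>i\<ge>N. \<forall>j\<ge>N. (\<integral>x. norm (Y i x - Y j x) \<partial>M) < e" if e: "e > 0" for e
  proof -
    have "e\<^sup>2 / 4 > 0" using e by simp
    from cauchy[OF this] obtain N where N: "\<And>m n. m \<ge> N \<Longrightarrow> n \<ge> N \<Longrightarrow> msq (\<lambda>x. Y m x - Y n x) \<le> e\<^sup>2 / 4"
      by blast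
    have "(\<integral>x. norm (Y i x - Y j x) \<partial>M) < e" if "i \<ge> N" "j \<ge> N" for i j
    proof -
      have b: "bfam (\<lambda>_ :: nat. \<lambda>x. Y i x - Y j x)"
        by (intro bfam_diff bfam_reindex[OF Y])
      have amgm: "a \<le> e / 4 + a\<^sup>2 / e" for a :: real
      proof -
        have "0 \<le> (a - e / 2)\<^sup>2 / e" using e by simp
        also have "\<dots> = e / 4 + a\<^sup>2 / e - a"
          using e by (simp add: field_simps power2_eq_square)
        finally show ?thesis by simp
      qed
      have "(\<integral>x. norm (Y i x - Y j x) \<partial>M) \<le> (\<integral>x. e / 4 + (cmod (Y i x - Y j x))\<^sup>2 / e \<partial>M)"
        by (intro integral_mono amgm integrable_norm bfam_integrable[OF b] Bochner_Integration.integrable_add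
            integrable_const integrable_divide bfam_integrable_square[OF b])
      also have "\<dots> = e / 4 + msq (\<lambda>x. Y i x - Y j x) / e"
        by (simp add: msq_def bfam_integrable_square[OF b] prob_space)
      also have "\<dots> \<le> e / 4 + (e\<^sup>2 / 4) / e"
        using N[OF that] e by (intro add_left_mono divide_right_mono) auto
      also have "\<dots> < e" using e by (simp add: power2_eq_square)
      finally show ?thesis .
    qed
    then show ?thesis by blast
  qed
  obtain r where r: "strict_mono r" "AE x in M. Cauchy (\<lambda>i. Y (r i) x)"
    using cauchy_L1_AE_cauchy_subseq[OF bfam_integrable[OF Y] L1] by blast
  define F where "F x = lim (\<lambda>i. Y (r i) x)" for x
  have F [measurable]: "F \<in> borel_measurable M" unfolding F_def by measurable
  have lim: "AE x in M. (\<lambda>i. Y (r i) x) \<longlonglongrightarrow> F x"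
    using r(2) by eventually_elim (simp add: F_def Cauchy_convergent convergent_LIMSEQ_iff[symmetric])
  have F_bound: "AE x in M. cmod (F x) \<le> C"
    using lim by eventually_elim (rule Lim_norm_ubound[OF sequentially_bot], auto simp: C(2))
  have F2: "AE x in M. norm ((cmod (F x))\<^sup>2) \<le> C\<^sup>2"
    using F_bound by eventually_elim (simp add: power_mono)
  have "integrable M (\<lambda>x. (cmod (F x))\<^sup>2)"
    by (rule integrable_const_bound[OF F2]) measurable
  moreover have "(\<lambda>n. msq (\<lambda>x. Y n x - F x)) \<longlonglongrightarrow> 0"
  proof (rule LIMSEQ_I)
    fix \<epsilon> :: real assume "\<epsilon> > 0"
    then have "\<epsilon> / 2 > 0" by simp
    from cauchy[OF this] obtain N where
      N: "\<And>m n. m \<ge> N \<Longrightarrow> n \<ge> N \<Longrightarrow> msq (\<lambda>x. Y m x - Y n x) \<le> \<epsilon> / 2"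
      by blast
    have "msq (\<lambda>x. Y n x - F x) \<le> \<epsilon> / 2" if "n \<ge> N" for n
    proof (rule LIMSEQ_le_const2)
      show "(\<lambda>i. msq (\<lambda>x. Y n x - Y (r i) x)) \<longlonglongrightarrow> msq (\<lambda>x. Y n x - F x)"
        unfolding msq_def
      proof (rule integral_dominated_convergence[where w = "\<lambda>_. (2 * C)\<^sup>2"])
        show "AE x in M. (\<lambda>i. (cmod (Y n x - Y (r i) x))\<^sup>2) \<longlonglongrightarrow> (cmod (Y n x - F x))\<^sup>2"
          using lim by eventually_elim (intro tendsto_intros)
        have "cmod (Y n x - Y (r i) x) \<le> 2 * C" for i x
          using norm_triangle_ineq4[of "Y n x" "Y (r i) x"] C(2)[of n x] C(2)[of "r i" x] by linarith
        from power_mono[OF this norm_ge_zero, where n = 2]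
        show "AE x in M. norm ((cmod (Y n x - Y (r i) x))\<^sup>2) \<le> (2 * C)\<^sup>2" for i
          by simp
      qed simp_all
      have "msq (\<lambda>x. Y n x - Y (r i) x) \<le> \<epsilon> / 2" if "i \<ge> N" for i
        using N[OF \<open>n \<ge> N\<close>, of "r i"] seq_suble[OF r(1), of i] that by simp
      then show "\<exists>K. \<forall>i\<ge>K. msq (\<lambda>x. Y n x - Y (r i) x) \<le> \<epsilon> / 2" by blast
    qed
    then show "\<exists>N. \<forall>n\<ge>N. norm (msq (\<lambda>x. Y n x - F x) - 0) < \<epsilon>"
      using \<open>\<epsilon> > 0\<close> by (intro exI[of _ N]) (fastforce simp: msq_nonneg)
  qed
  ultimately show thesis using that[OF F] by blast
qed

text \<open>
  The inductive statement is used with constant families and with the mean that evaluates a sequence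
  at the index 0.
\<close>

lemma bounded_averages_converge:
  assumes ps: "is_system G ps" "finite_complexity G ps"
    and f: "\<And>i. i < length ps \<Longrightarrow> bfam (\<lambda>_ :: nat. f i)"
  obtains F where "F \<in> borel_measurable M" "integrable M (\<lambda>x. (cmod (F x))\<^sup>2)"
    "(\<lambda>N. msq (\<lambda>x. cesaro N (\<lambda>n. \<Prod>i < length ps. f i (T ((ps ! i) (int n)) x)) - F x)) \<longlonglongrightarrow> 0"
proof -
  obtain l qs where steps: "(system_step G)\<^sup>*\<^sup>* (0, map (\<lambda>p. Base \<circ> p) ps) (l, qs)" "trivial_system qs"
    using ps(2) unfolding finite_complexity_def by blast
  have carrier: "carrier (tower_group G 0) = Base ` carrier G"
    by (simp add: image_group_carrier)
  have "is_system (tower_group G 0) (map (\<lambda>p. Base \<circ> p) ps)"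
    using ps(1) unfolding is_system_def by (auto simp: carrier PiE_iff simp del: tower_group.simps)
  from convergent_on_finite_complexity[OF steps this]
  have conv: "convergent_on 0 (set (map (\<lambda>p. Base \<circ> p) ps))" .
  define c :: "nat \<Rightarrow> 'g tower \<Rightarrow> 'g" where "c i s = (case s of Base g \<Rightarrow> g | Seq _ \<Rightarrow> \<one>)" for i s
  have c: "c i \<in> hom (tower_group G 0) G" for i
  proof (rule homI)
    fix s assume "s \<in> carrier (tower_group G 0)"
    then obtain g where g: "g \<in> carrier G" "s = Base g" unfolding carrier by blast
    then show "c i s \<in> carrier G" by (simp add: c_def)
    fix s' assume "s' \<in> carrier (tower_group G 0)"
    then obtain g' where g': "g' \<in> carrier G" "s' = Base g'" unfolding carrier by blast
    have "Base \<in> hom G (tower_group G 0)"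
      using Base_iso[OF is_group] by (simp only: iso_def mem_Collect_eq)
    from hom_mult[OF this g(1) g'(1), symmetric]
    show "c i (s \<otimes>\<^bsub>tower_group G 0\<^esub> s') = c i s \<otimes> c i s'"
      unfolding g(2) g'(2) by (simp add: c_def del: tower_group.simps)
  qed
  define L where "L = map (\<lambda>i. (Base \<circ> ps ! i, \<lambda>_ :: nat. f i)) [0..<length ps]"
  have L: "\<forall>(q, F) \<in> set L. q \<in> set (map (\<lambda>p. Base \<circ> p) ps) \<and> bfam F"
    using f by (auto simp: L_def)
  define \<Phi> :: "(nat \<Rightarrow> real) \<Rightarrow> real" where "\<Phi> b = b 0" for b
  have \<Phi>: "is_mean \<Phi>" by (simp add: is_mean_def \<Phi>_def)
  have "mean_cauchy \<Phi> (averages c L)"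
    using conv c \<Phi> L unfolding convergent_on_def by blast
  define Y where "Y N x = cesaro N (\<lambda>n. \<Prod>i < length ps. f i (T ((ps ! i) (int n)) x))" for N x
  have "list_product c L n i x = (\<Prod>i < length ps. f i (T ((ps ! i) (int n)) x))" for n i x
    unfolding list_product_def L_def
    by (simp add: c_def comp_def prod.list_conv_set_nth atLeast0LessThan flip: prod.distinct_set_conv_list)
  then have avg: "averages c L N i x = Y N x" for N i x
    by (simp add: averages_def Y_def)
  have cauchyY: "\<exists>N\<^sub>0. \<forall>m \<ge> N\<^sub>0. \<forall>n \<ge> N\<^sub>0. msq (\<lambda>x. Y m x - Y n x) \<le> \<epsilon>" if "\<epsilon> > 0" for \<epsilon>
    using \<open>mean_cauchy \<Phi> (averages c L)\<close> that unfolding mean_cauchy_def mean_msq_def \<Phi>_def avg by blast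
  have bY: "bfam Y"
  proof -
    have "c i (q n) \<in> carrier G" if "(q, F) \<in> set L" for i q F n
      using that ps(1) unfolding is_system_def by (auto simp: L_def c_def PiE_iff)
    then have "weights (list_product c L)"
      using L by (intro weights_list_product) auto
    from bfam_cesaro[OF weights_bfam[OF this, of fst "\<lambda>_. 0"], of "\<lambda>N. N"]
    have "bfam (\<lambda>N. averages c L N 0)" unfolding averages_def .
    then show ?thesis unfolding avg[abs_def] .
  qed
  obtain F where "F \<in> borel_measurable M" "integrable M (\<lambda>x. (cmod (F x))\<^sup>2)"
    "(\<lambda>N. msq (\<lambda>x. Y N x - F x)) \<longlonglongrightarrow> 0"
    by (rule L2_complete_bounded[OF bY cauchyY])
  then show thesis by (rule that[unfolded Y_def[symmetric]])
qed

end

theorem theorem2p2: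
  fixes G :: "('g, 'b) monoid_scheme"
    and T :: "'g \<Rightarrow> 'x :: metric_space \<Rightarrow> 'x"
    and \<mu> :: "'x measure"
    and ps :: "(int \<Rightarrow> 'g) list"
    and f :: "nat \<Rightarrow> 'x \<Rightarrow> complex"
  assumes "group G" and "countable (carrier G)"
    and "compact (UNIV :: 'x set)"
    and "prob_space \<mu>" and "sets \<mu> = sets borel"
    and "group_action G UNIV T"
    and "\<And>g. g \<in> carrier G \<Longrightarrow> \<exists>S. homeomorphism UNIV UNIV (T g) S"
    and "\<And>g. g \<in> carrier G \<Longrightarrow> distr \<mu> \<mu> (T g) = \<mu>"
    and "is_system G ps" and "finite_complexity G ps"
    and "\<And>i. i < length ps \<Longrightarrow> f i \<in> L_infinity \<mu>"
  shows "\<exists>F \<in> L_two \<mu>.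
    (\<lambda>N. L_two_norm \<mu> (\<lambda>x.
        (1 / of_nat N) * (\<Sum>n = 1..N. \<Prod>i < length ps. f i (T ((ps ! i) (int n)) x)) - F x))
      \<longlonglongrightarrow> 0"
proof -
  have space: "space \<mu> = UNIV"
    using sets_eq_imp_space_eq[OF assms(5)] by simp
  have T_meas: "T g \<in> measurable \<mu> \<mu>" if "g \<in> carrier G" for g
  proof -
    have "continuous_on UNIV (T g)"
      using assms(7)[OF that] unfolding homeomorphism_def by blast
    then show ?thesis
      using borel_measurable_continuous_onI measurable_cong_sets[OF assms(5) assms(5)] by blast
  qed
  interpret pmp_action G \<mu> T
  proof (intro pmp_action.intro pmp_action_axioms.intro assms(1,4) space T_meas assms(8))
    show "T (g \<otimes>\<^bsub>G\<^esub> h) x = T g (T h x)" if "g \<in> carrier G" "h \<in> carrier G" for g h x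
      using group_action.composition_rule[OF assms(6) UNIV_I that] .
    show "T \<one>\<^bsub>G\<^esub> x = x" for x
      using group_action.id_eq_one[OF assms(6)] by (metis UNIV_I restrict_apply')
  qed

  have "\<exists>C. AE x in \<mu>. cmod (f i x) \<le> C" if "i < length ps" for i
    using assms(11)[OF that] unfolding L_infinity_def by blast
  then obtain C where C: "AE x in \<mu>. cmod (f i x) \<le> C i" if "i < length ps" for i
    by metis
  have f_meas: "f i \<in> borel_measurable \<mu>" if "i < length ps" for i
    using assms(11)[OF that] unfolding L_infinity_def by blast
  \<comment> \<open>Truncation makes the functions bounded everywhere and alters the averages on a null set only,
    because the action preserves null sets.\<close>
  define h where "h i x = (if cmod (f i x) \<le> C i then f i x else 0)" for i x
  have h: "bfam (\<lambda>_ :: nat. h i)" if "i < length ps" for i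
  proof (rule bfamI)
    note [measurable] = f_meas[OF that]
    show "h i \<in> borel_measurable \<mu>" unfolding h_def by measurable
    show "cmod (h i x) \<le> max 0 (C i)" for x by (simp add: h_def max.coboundedI2)
  qed
  have ps_carrier: "(ps ! i) n \<in> carrier G" if "i < length ps" for i n
    using assms(9) nth_mem[OF that] unfolding is_system_def by (auto simp: PiE_iff)
  have AE_term: "AE x in \<mu>. f i (T ((ps ! i) (int n)) x) = h i (T ((ps ! i) (int n)) x)"
    if "i < length ps" for i n
  proof (rule AE_distrD[where M' = \<mu> and f = "T ((ps ! i) (int n))" and P = "\<lambda>x. f i x = h i x"])
    show "T ((ps ! i) (int n)) \<in> measurable \<mu> \<mu>"
      by (rule T_meas[OF ps_carrier[OF that]])
    show "AE x in distr \<mu> \<mu> (T ((ps ! i) (int n))). f i x = h i x"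
      unfolding assms(8)[OF ps_carrier[OF that]]
      using C[OF that] by eventually_elim (simp add: h_def)
  qed
  have "AE x in \<mu>. \<forall>n. \<forall>i \<in> {..<length ps}. f i (T ((ps ! i) (int n)) x) = h i (T ((ps ! i) (int n)) x)"
    unfolding AE_all_countable by (intro allI AE_finite_allI AE_term) auto
  then have AE_avg: "AE x in \<mu>. \<forall>N. cesaro N (\<lambda>n. \<Prod>i < length ps. f i (T ((ps ! i) (int n)) x)) =
      cesaro N (\<lambda>n. \<Prod>i < length ps. h i (T ((ps ! i) (int n)) x))"
    by eventually_elim (simp add: cesaro_def)

  obtain F where F: "F \<in> borel_measurable \<mu>" "integrable \<mu> (\<lambda>x. (cmod (F x))\<^sup>2)"
    and lim: "(\<lambda>N. msq (\<lambda>x. cesaro N (\<lambda>n. \<Prod>i < length ps. h i (T ((ps ! i) (int n)) x)) - F x)) \<longlonglongrightarrow> 0"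
    using bounded_averages_converge[where f = h, OF assms(9,10) h] by blast
  have "L_two_norm \<mu> (\<lambda>x. (1 / of_nat N) * (\<Sum>n = 1..N. \<Prod>i < length ps. f i (T ((ps ! i) (int n)) x)) - F x) =
      sqrt (msq (\<lambda>x. cesaro N (\<lambda>n. \<Prod>i < length ps. h i (T ((ps ! i) (int n)) x)) - F x))" for N
  proof -
    have comp: "(\<lambda>x. k i (T ((ps ! i) (int n)) x)) \<in> borel_measurable \<mu>"
      if "k i \<in> borel_measurable \<mu>" "i < length ps" for k :: "nat \<Rightarrow> 'x \<Rightarrow> complex" and i n
      by (rule measurable_compose[OF T_meas[OF ps_carrier[OF that(2)]] that(1)])
    have avg: "(\<lambda>x. cesaro N (\<lambda>n. \<Prod>i < length ps. k i (T ((ps ! i) (int n)) x))) \<in> borel_measurable \<mu>"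
      if "\<And>i. i < length ps \<Longrightarrow> k i \<in> borel_measurable \<mu>" for k :: "nat \<Rightarrow> 'x \<Rightarrow> complex"
      by (intro cesaro_measurable borel_measurable_prod comp that) auto
    note [measurable] = F(1) avg[of f, OF f_meas] avg[of h, OF bfam_measurable[OF h]]
    show ?thesis
      unfolding L_two_norm_def msq_def cesaro_def[symmetric]
      by (intro arg_cong[of _ _ sqrt] integral_cong_AE)
        (measurable, use AE_avg in \<open>eventually_elim, simp\<close>)
  qed
  moreover have "(\<lambda>N. sqrt (msq (\<lambda>x. cesaro N (\<lambda>n. \<Prod>i < length ps. h i (T ((ps ! i) (int n)) x)) - F x))) \<longlonglongrightarrow> 0"
    using tendsto_real_sqrt[OF lim] by simp
  ultimately show ?thesis
    using F unfolding L_two_def by (intro bexI[of _ F]) simp_all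
qed

end
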